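(* Let $T>0$, $\mu^0 \in \mathcal{P}_c(\mathbb{R}^d)$, let $(\mathbf{U},d_{\mathbf{U}})$ be a metric space, let $U(t,\mu) \subset \mathbf{U}$, $(t,\mu) \in [0,T]\times\mathcal{P}_c(\mathbb{R}^d)$, be a family of compact subsets, and let $v : [0,T] \times \mathcal{P}_c(\mathbb{R}^d) \times \mathbf{U} \to C^0(\mathbb{R}^d,\mathbb{R}^d)$. Suppose that for any compact set $K \subset \mathbb{R}^d$ the following holds. (i) The set-valued map $(t,\mu) \mapsto U(t,\mu) \subset \mathbf{U}$ is $\mathcal{L}^1$-measurable in $t \in [0,T]$ and continuous with respect to $\mu \in \mathcal{P}_c(\mathbb{R}^d)$ in the $W_1$-metric. (ii) The map $(t,\mu,u,x) \mapsto v(t,\mu,u)(x) \in \mathbb{R}^d$ is $\mathcal{L}^1$-measurable with respect to $t \in [0,T]$ and continuous with respect to $(u,x) \in \mathbf{U} \times \mathbb{R}^d$. Moreover, there exists $m \in L^1([0,T],\mathbb{R}_+)$ such that for $\mathcal{L}^1$-a.e. $t \in [0,T]$, $|v(t,\mu,u)(x)| \leq m(t)(1+|x|+\mathcal{M}_1(\mu))$ for all $(\mu,u,x) \in \mathcal{P}_c(\mathbb{R}^d) \times \mathbf{U} \times \mathbb{R}^d$. There exist $l_K, L_K \in L^1([0,T],\mathbb{R}_+)$ such that for $\mathcal{L}^1$-a.e. $t \in [0,T]$, $\mathrm{Lip}(v(t,\mu,u);K) \leq l_K(t)$ for any $(\mu,u) \in \mathcal{P}(K) \times \mathbf{U}$,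 and $\| v(t,\mu,u) - v(t,\nu,u) \|_{C^0(K,\mathbb{R}^d)} \leq L_K(t) W_1(\mu,\nu)$ for any $\mu,\nu \in \mathcal{P}(K)$ and $u \in \mathbf{U}$. Define the set-valued map $V : [0,T]\times\mathcal{P}_c(\mathbb{R}^d) \rightrightarrows C^0(\mathbb{R}^d,\mathbb{R}^d)$ by $V(t,\mu) := v(t,\mu,U(t,\mu)) = \{ v(t,\mu,u) : u \in U(t,\mu) \}$. Then a curve $\mu(\cdot)$ solves the differential inclusion $$\partial_t \mu(t) \in - \mathrm{div} \big( V(t,\mu(t)) \mu(t) \big), \qquad \mu(0) = \mu^0,$$ if and only if it is a solution of the controlled dynamics $$\partial_t \mu(t) + \mathrm{div} \big( v(t,\mu(t),u(t)) \mu(t) \big) = 0, \qquad \mu(0) = \mu^0,$$ for some admissible control, i.e. some measurable selection $t \in [0,T] \mapsto u(t) \in U(t,\mu(t))$.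
   Context: Notation. $\mathcal{P}(\mathbb{R}^d)$ is the set of Borel probability measures on $\mathbb{R}^d$; $\mathcal{P}_c(\mathbb{R}^d)$ is the subset of those with compact support; for $K \subset \mathbb{R}^d$, $\mathcal{P}(K)$ is the set of probability measures supported in $K$. $\mathcal{M}_1(\mu) := \int_{\mathbb{R}^d} |x| \, \mathrm{d}\mu(x)$. $W_1(\mu,\nu) := \min_{\gamma} \int_{\mathbb{R}^{2d}} |x-y| \, \mathrm{d}\gamma(x,y)$, the minimum being over all transport plans $\gamma$ between $\mu$ and $\nu$ (1-Wasserstein distance). $\mathcal{P}_c(\mathbb{R}^d)$ is endowed with $W_1$ and $\mathrm{AC}([0,T],\mathcal{P}_c(\mathbb{R}^d))$ denotes the curves absolutely continuous for $W_1$. $\mathcal{L}^1$ is the Lebesgue measure on $[0,T]$. $\mathrm{Lip}(v;K)$ is the Lipschitz constant of $v$ on $K$. Continuity equation. A curve $\mu(\cdot) \in \mathrm{AC}([0,T],\mathcal{P}_c(\mathbb{R}^d))$ solves $\partial_t \mu(t) + \mathrm{div}(v(t)\mu(t)) = 0$, $\mu(0)=\mu^0$, if $\mu(0)=\mu^0$ and $$\int_0^T \int_{\mathbb{R}^d} \big( \partial_t \phi(t,x) + \langle \nabla_x \phi(t,x), v(t,x) \rangle \big) \mathrm{d}\mu(t)(x) \, \mathrm{d}t = 0$$ for every $\phi \in C^\infty_c((0,T) \times \mathbb{R}^d)$. The controlled dynamics is understood in this sense with velocity field $(t,x) \mapsto v(t,\mu(t),u(t))(x)$. Differential inclusion. A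 curve $\mu(\cdot)$ solves $\partial_t \mu(t) \in -\mathrm{div}(V(t,\mu(t))\mu(t))$, $\mu(0)=\mu^0$, if there exists a measurable selection $t \in [0,T] \mapsto \boldsymbol{v}(t) \in V(t,\mu(t))$ (the membership holding for $\mathcal{L}^1$-a.e. $t$) such that $\mu(\cdot)$ solves the continuity equation driven by $(t,x) \mapsto \boldsymbol{v}(t)(x)$ with $\mu(0)=\mu^0$. Set-valued maps. A set-valued map $\mathcal{F} : [0,T] \rightrightarrows \mathcal{S}$ into a metric space is $\mathcal{L}^1$-measurable if $\{t : \mathcal{F}(t) \cap \mathcal{O} \neq \emptyset\}$ is $\mathcal{L}^1$-measurable for every open $\mathcal{O} \subset \mathcal{S}$. A measurable selection in $\mathcal{F}$ is a measurable map $f$ with $f(t) \in \mathcal{F}(t)$ for $\mathcal{L}^1$-a.e. $t$. Continuity of a set-valued map means both upper and lower semicontinuity. *)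

theory Defs
  imports "HOL-Probability.Probability"
begin

section \<open>Probability measures and the 1-Wasserstein distance\<close>

definition msupp :: "'a::topological_space measure \<Rightarrow> 'a set" where
  "msupp \<mu> = {x. \<forall>W. open W \<and> x \<in> W \<longrightarrow> 0 < emeasure \<mu> W}"

definition borel_probs :: "'a::topological_space measure set" where
  "borel_probs = {\<mu>. sets \<mu> = sets borel \<and> prob_space \<mu>}"

definition probs_on :: "'a::topological_space set \<Rightarrow> 'a measure set" where
  "probs_on K = {\<mu> \<in> borel_probs. msupp \<mu> \<subseteq> K}"

definition probs_c :: "'a::topological_space measure set" where
  "probs_c = {\<mu> \<in> borel_probs. compact (msupp \<mu>)}"

definition moment1 :: "'a::real_normed_vector measure \<Rightarrow> real" where
  "moment1 \<mu> = (\<integral>x. norm x \<partial>\<mu>)"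

definition transport_plans ::
    "'a::topological_space measure \<Rightarrow> 'a measure \<Rightarrow> ('a \<times> 'a) measure set" where
  "transport_plans \<mu> \<nu> =
     {\<gamma>. sets \<gamma> = sets borel \<and> distr \<gamma> borel fst = \<mu> \<and> distr \<gamma> borel snd = \<nu>}"

text \<open>
  The infimum is taken in the extended nonnegative reals, so that a plan of infinite cost does not
  count as one of cost 0. It is finite (and attained) for compactly supported measures, the only
  ones to which \<open>W1\<close> is applied.
\<close>
definition W1 :: "'a::metric_space measure \<Rightarrow> 'a measure \<Rightarrow> real" where
  "W1 \<mu> \<nu> =
     enn2real (INF \<gamma> \<in> transport_plans \<mu> \<nu>. \<integral>\<^sup>+p. ennreal (dist (fst p) (snd p)) \<partial>\<gamma>)"


section \<open>Integrable functions and absolutely continuous curves\<close>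

definition L1_nonneg :: "real \<Rightarrow> (real \<Rightarrow> real) set" where
  "L1_nonneg T = {m. integrable (lebesgue_on {0..T}) m \<and> (\<forall>t\<in>{0..T}. 0 \<le> m t)}"

text \<open>
  Absolutely continuous curves from \<open>{0..T}\<close> to the set \<open>X\<close> with distance \<open>d\<close>.
  Values outside \<open>{0..T}\<close> are irrelevant.
\<close>
definition AC_curves :: "real \<Rightarrow> 'x set \<Rightarrow> ('x \<Rightarrow> 'x \<Rightarrow> real) \<Rightarrow> (real \<Rightarrow> 'x) set" where
  "AC_curves T X d =
     {c. (\<forall>t\<in>{0..T}. c t \<in> X) \<and>
         (\<exists>m\<in>L1_nonneg T. \<forall>s t. 0 \<le> s \<and> s \<le> t \<and> t \<le> T \<longrightarrow>
            d (c s) (c t) \<le> (\<integral>r. m r \<partial>lebesgue_on {s..t}))}"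


section \<open>Continuous vector fields\<close>

definition C0 :: "('a::topological_space \<Rightarrow> 'b::topological_space) set" where
  "C0 = {f. continuous_on UNIV f}"

definition C0_norm :: "'a set \<Rightarrow> ('a \<Rightarrow> 'b::real_normed_vector) \<Rightarrow> real" where
  "C0_norm K f = (SUP x\<in>K. norm (f x))"

text \<open>Topology of uniform convergence on compact sets.\<close>
definition C0_topology :: "('a::topological_space \<Rightarrow> 'b::metric_space) topology" where
  "C0_topology = topology (\<lambda>W. W \<subseteq> C0 \<and>
     (\<forall>f\<in>W. \<exists>K e. compact K \<and> 0 < e \<and>
        {g \<in> C0. \<forall>x\<in>K. dist (g x) (f x) < e} \<subseteq> W))"

lemma openin_C0_topology:
  "openin C0_topology (W :: ('a::topological_space \<Rightarrow> 'b::metric_space) set) \<longleftrightarrow>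
     W \<subseteq> C0 \<and> (\<forall>f\<in>W. \<exists>K e. compact K \<and> 0 < e \<and>
        {g \<in> C0. \<forall>x\<in>K. dist (g x) (f x) < e} \<subseteq> W)"
proof -
  define B :: "('a \<Rightarrow> 'b) \<Rightarrow> 'a set \<Rightarrow> real \<Rightarrow> ('a \<Rightarrow> 'b) set"
    where "B = (\<lambda>f K e. {g \<in> C0. \<forall>x\<in>K. dist (g x) (f x) < e})"
  define nb where "nb = (\<lambda>f W. \<exists>K e. compact K \<and> 0 < e \<and> B f K e \<subseteq> W)"
  have nb_mono: "nb f W'" if "nb f W" "W \<subseteq> W'" for f W W'
    using that unfolding nb_def by (meson order_trans)
  have nb_Int: "nb f (S \<inter> R)" if S: "nb f S" and R: "nb f R" for f S R
  proof -
    obtain K e where 1: "compact K" "0 < e" "B f K e \<subseteq> S"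
      using S unfolding nb_def by auto
    obtain K' e' where 2: "compact K'" "0 < e'" "B f K' e' \<subseteq> R"
      using R unfolding nb_def by auto
    have "B f (K \<union> K') (min e e') \<subseteq> B f K e" "B f (K \<union> K') (min e e') \<subseteq> B f K' e'"
      by (auto simp: B_def)
    with 1 2 have "B f (K \<union> K') (min e e') \<subseteq> S \<inter> R" by (meson Int_greatest order_trans)
    with 1 2 show ?thesis
      unfolding nb_def by (intro exI[of _ "K \<union> K'"] exI[of _ "min e e'"]) (simp add: compact_Un)
  qed
  have "istopology (\<lambda>W. W \<subseteq> C0 \<and> (\<forall>f\<in>W. nb f W))"
    unfolding istopology_def
  proof (intro conjI allI impI)
    fix S R assume *: "S \<subseteq> C0 \<and> (\<forall>f\<in>S. nb f S)" "R \<subseteq> C0 \<and> (\<forall>f\<in>R. nb f R)"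
    then show "S \<inter> R \<subseteq> C0" by auto
    show "\<forall>f\<in>S \<inter> R. nb f (S \<inter> R)" using * by (simp add: nb_Int)
  next
    fix \<K> assume *: "\<forall>W\<in>\<K>. W \<subseteq> C0 \<and> (\<forall>f\<in>W. nb f W)"
    then show "\<Union>\<K> \<subseteq> C0" by (simp add: Sup_le_iff)
    show "\<forall>f\<in>\<Union>\<K>. nb f (\<Union>\<K>)"
    proof
      fix f assume "f \<in> \<Union>\<K>"
      then obtain W where "W \<in> \<K>" "f \<in> W" by (rule UnionE)
      then show "nb f (\<Union>\<K>)" using * by (intro nb_mono[OF _ Union_upper[of W]]) simp_all
    qed
  qed
  then show ?thesis
    unfolding C0_topology_def nb_def B_def by (simp add: topology_inverse')
qed

definition C0_borel :: "('a::topological_space \<Rightarrow> 'b::metric_space) measure" where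
  "C0_borel = sigma C0 {W. openin C0_topology W}"


section \<open>Set-valued maps\<close>

definition setmap_measurable :: "real \<Rightarrow> (real \<Rightarrow> 's::topological_space set) \<Rightarrow> bool" where
  "setmap_measurable T F \<longleftrightarrow>
     (\<forall>W. open W \<longrightarrow> {t \<in> {0..T}. F t \<inter> W \<noteq> {}} \<in> sets lebesgue)"

definition setmap_lsc ::
    "'x set \<Rightarrow> ('x \<Rightarrow> 'x \<Rightarrow> real) \<Rightarrow> ('x \<Rightarrow> 's::topological_space set) \<Rightarrow> bool" where
  "setmap_lsc X d F \<longleftrightarrow>
     (\<forall>x\<in>X. \<forall>W. open W \<and> F x \<inter> W \<noteq> {} \<longrightarrow>
        (\<exists>\<delta>>0. \<forall>y\<in>X. d x y < \<delta> \<longrightarrow> F y \<inter> W \<noteq> {}))"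

definition setmap_usc ::
    "'x set \<Rightarrow> ('x \<Rightarrow> 'x \<Rightarrow> real) \<Rightarrow> ('x \<Rightarrow> 's::topological_space set) \<Rightarrow> bool" where
  "setmap_usc X d F \<longleftrightarrow>
     (\<forall>x\<in>X. \<forall>W. open W \<and> F x \<subseteq> W \<longrightarrow>
        (\<exists>\<delta>>0. \<forall>y\<in>X. d x y < \<delta> \<longrightarrow> F y \<subseteq> W))"

definition setmap_continuous ::
    "'x set \<Rightarrow> ('x \<Rightarrow> 'x \<Rightarrow> real) \<Rightarrow> ('x \<Rightarrow> 's::topological_space set) \<Rightarrow> bool" where
  "setmap_continuous X d F \<longleftrightarrow> setmap_lsc X d F \<and> setmap_usc X d F"

text \<open>
  The target measurable space is a parameter: \<open>borel\<close> for controls, \<open>C0_borel\<close> for vector fields.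
\<close>
definition measurable_selection ::
    "real \<Rightarrow> 's measure \<Rightarrow> (real \<Rightarrow> 's set) \<Rightarrow> (real \<Rightarrow> 's) \<Rightarrow> bool" where
  "measurable_selection T S F f \<longleftrightarrow>
     f \<in> measurable (lebesgue_on {0..T}) S \<and> (AE t in lebesgue_on {0..T}. f t \<in> F t)"


section \<open>Test functions\<close>

fun C_k :: "nat \<Rightarrow> ('a::real_normed_vector \<Rightarrow> 'b::real_normed_vector) \<Rightarrow> bool" where
  "C_k 0 f \<longleftrightarrow> continuous_on UNIV f"
| "C_k (Suc k) f \<longleftrightarrow>
     (\<forall>x. f differentiable (at x)) \<and> (\<forall>h. C_k k (\<lambda>x. frechet_derivative f (at x) h))"

text \<open>
  An element of \<open>C_c^\<infinity>((0,T) \<times> R^d)\<close> is identified with its extension by zero to the whole space.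
\<close>
definition test_functions :: "real \<Rightarrow> (real \<times> 'a::real_normed_vector \<Rightarrow> real) set" where
  "test_functions T =
     {\<phi>. (\<forall>k. C_k k \<phi>) \<and>
         compact (closure {p. \<phi> p \<noteq> 0}) \<and> closure {p. \<phi> p \<noteq> 0} \<subseteq> {0<..<T} \<times> UNIV}"

definition grad :: "('a::real_inner \<Rightarrow> real) \<Rightarrow> 'a \<Rightarrow> 'a" where
  "grad f x = (THE D. GDERIV f x :> D)"


section \<open>Continuity equation and differential inclusion\<close>

text \<open>
  Integrability is required explicitly because the Bochner integral of a non-integrable function
  is 0 by convention.
\<close>
definition solves_continuity_eq ::
    "real \<Rightarrow> (real \<Rightarrow> 'a::euclidean_space \<Rightarrow> 'a) \<Rightarrow> 'a measure \<Rightarrow> (real \<Rightarrow> 'a measure) \<Rightarrow> bool" where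
  "solves_continuity_eq T w \<mu>0 \<mu> \<longleftrightarrow>
     \<mu> \<in> AC_curves T probs_c W1 \<and> \<mu> 0 = \<mu>0 \<and>
     (\<forall>\<phi> \<in> test_functions T.
        let g = (\<lambda>t x. deriv (\<lambda>s. \<phi> (s, x)) t + grad (\<lambda>y. \<phi> (t, y)) x \<bullet> w t x) in
          (AE t in lebesgue_on {0..T}. integrable (\<mu> t) (g t)) \<and>
          integrable (lebesgue_on {0..T}) (\<lambda>t. \<integral>x. g t x \<partial>\<mu> t) \<and>
          (\<integral>t. (\<integral>x. g t x \<partial>\<mu> t) \<partial>lebesgue_on {0..T}) = 0)"

definition solves_inclusion ::
    "real \<Rightarrow> (real \<Rightarrow> 'a::euclidean_space measure \<Rightarrow> ('a \<Rightarrow> 'a) set) \<Rightarrow>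
     'a measure \<Rightarrow> (real \<Rightarrow> 'a measure) \<Rightarrow> bool" where
  "solves_inclusion T V \<mu>0 \<mu> \<longleftrightarrow>
     (\<exists>w. measurable_selection T C0_borel (\<lambda>t. V t (\<mu> t)) w \<and> solves_continuity_eq T w \<mu>0 \<mu>)"

end

theory Submission
  imports Defs
begin

text \<open>
  Along the curve, \<open>F t = U t (\<mu> t)\<close> is a measurable compact-valued map and \<open>g t u x = v t (\<mu> t) u x\<close> is
  measurable in \<open>t\<close> and continuous in \<open>u\<close> and \<open>x\<close>: both follow by sampling the curve at grid points. An
  admissible control yields a velocity field by composition, and a velocity field in \<open>g t ` F t\<close> yields a
  control by Filippov's measurable selection argument. Both arguments need controls with values in a
  separable set, whereas the control space is an arbitrary metric space. This comes for free: a
  measurable compact-valued map on an interval with Lebesgue measure has almost all its values inside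
  one separable set. The reason is that a point-finite family of null sets all of whose subfamilies have
  measurable unions has a null union; otherwise a real function with null fibres and measurable preimages
  of all sets would, after composition with its distribution function, make every subset of an interval
  Lebesgue measurable.
\<close>

section \<open>Null-fibred functions and point-finite families\<close>

text \<open>Separability matters because both directions sample a control at countably many points:
  a Borel measurable map into a nonseparable metric space need not be a limit of countably valued
  measurable maps, and then measurability of \<open>g t u x\<close> in \<open>t\<close> for each
  fixed \<open>u\<close> says little about \<open>g t (u t) x\<close>. That all preimages under a
  null-fibred real function are measurable is not absurd in itself: a real-valued measurable
  cardinal not above the continuum would give an extension of Lebesgue measure to all subsets of an
  interval. The contradiction has to use that the preimages are Lebesgue sets of the real line. Such
  sets are approximated from inside by compact sets on which the function is continuous, so the
  approximation passes to the images. Sets in the range then become measurable for Lebesgue measure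
  itself and not only for some extension of it, and a Vitali set refutes this.\<close>

lemma AE_measurable_complete:
  assumes "complete_measure M" "f \<in> measurable M N" "AE x in M. f x = g x" "g \<in> space M \<rightarrow> space N"
  shows "g \<in> measurable M N"
proof (rule measurableI)
  interpret complete_measure M by fact
  fix A assume A: "A \<in> sets N"
  show "g -` A \<inter> space M \<in> sets M"
  proof (rule in_sets_AE)
    show "AE x in M. x \<in> f -` A \<inter> space M \<longleftrightarrow> x \<in> g -` A \<inter> space M" using assms(3) by eventually_elim auto
    show "f -` A \<inter> space M \<in> sets M" using assms(2) A by (rule measurable_sets)
  qed auto
qed (use assms in auto)

lemma complete_measure_lebesgue_on:
  assumes "S \<in> sets lebesgue"
  shows "complete_measure (lebesgue_on S)"
proof
  fix A B assume "B \<subseteq> A" and "A \<in> null_sets (lebesgue_on S)"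
  then have A: "A \<in> null_sets lebesgue" "A \<subseteq> S"
    using null_sets_restrict_space[OF assms] by auto
  then have "B \<in> null_sets lebesgue" using \<open>B \<subseteq> A\<close> completion.complete2 by blast
  then show "B \<in> sets (lebesgue_on S)"
    using \<open>A \<subseteq> S\<close> \<open>B \<subseteq> A\<close> assms by (auto simp: sets_restrict_space_iff)
qed

text \<open>Vitali's construction, with \<open>r\<close> choosing in {0..c} a representative of each
  class modulo the rationals. The rational translates of \<open>V\<close> are disjoint and cover the
  line, so \<open>V\<close> cannot be null. If its measure \<open>m\<close> is positive, more than
  (c + 1) / m translates by rationals of {0..1} lie disjointly in {0..c + 1}, which is too short for
  them.\<close>

lemma ex_nonmeasurable_subset:
  fixes c :: real
  assumes "0 < c"
  shows "\<exists>A \<subseteq> {0..c}. A \<notin> sets lebesgue"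
proof (rule ccontr)
  assume "\<not> ?thesis"
  then have all: "A \<in> sets lebesgue" if "A \<subseteq> {0..c}" for A using that by blast
  define r where "r x = (SOME y. y \<in> {0..c} \<and> x - y \<in> \<rat>)" for x :: real
  have r: "r x \<in> {0..c} \<and> x - r x \<in> \<rat>" for x
  proof -
    obtain q where "q \<in> \<rat>" "x - c < q" "q < x" using Rats_dense_in_real[of "x - c" x] assms by auto
    then have "x - q \<in> {0..c} \<and> x - (x - q) \<in> \<rat>" by auto
    then show ?thesis unfolding r_def by (rule someI)
  qed
  have r_eq: "r x = r y" if "x - y \<in> \<rat>" for x y
  proof -
    have "x - z \<in> \<rat> \<longleftrightarrow> y - z \<in> \<rat>" for z
    proof
      assume "x - z \<in> \<rat>"
      from Rats_diff[OF this that] show "y - z \<in> \<rat>" by simp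
    next
      assume "y - z \<in> \<rat>"
      from Rats_add[OF this that] show "x - z \<in> \<rat>" by simp
    qed
    then show ?thesis unfolding r_def by simp
  qed
  define V where "V = range r"
  have V: "V \<in> sets lebesgue" "V \<subseteq> {0..c}" using r by (auto simp: V_def intro!: all)
  have trans: "emeasure lebesgue ((+) q ` V) = emeasure lebesgue V" for q
    using emeasure_lebesgue_affine[of 1 q V] by (simp add: add.commute[of q] image_def)
  have trans_sets: "(+) q ` V \<in> sets lebesgue" for q
    using V(1) by (rule lebesgue_sets_translation)
  have disj: "disjoint_family_on (\<lambda>q. (+) q ` V) \<rat>"
    unfolding disjoint_family_on_def
  proof (intro ballI impI)
    fix p q :: real assume pq: "p \<in> \<rat>" "q \<in> \<rat>" "p \<noteq> q"
    show "(+) p ` V \<inter> (+) q ` V = {}"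
    proof (rule ccontr)
      assume "(+) p ` V \<inter> (+) q ` V \<noteq> {}"
      then obtain x y where xy: "p + r x = q + r y" by (auto simp: V_def)
      have "(x - r x) - (y - r y) + (q - p) \<in> \<rat>"
        using Rats_add[OF Rats_diff[OF conjunct2[OF r] conjunct2[OF r]] Rats_diff[OF pq(2) pq(1)]] .
      moreover have "(x - r x) - (y - r y) + (q - p) = x - y" using xy by simp
      ultimately have "x - y \<in> \<rat>" by simp
      then show False using r_eq xy pq by fastforce
    qed
  qed
  have cov: "UNIV = (\<Union>q\<in>\<rat>. (+) q ` V)"
  proof (intro set_eqI iffI UNIV_I)
    fix x :: real
    have "x = (x - r x) + r x" by simp
    then show "x \<in> (\<Union>q\<in>\<rat>. (+) q ` V)" using r[of x] by (auto simp: V_def intro!: bexI[of _ "x - r x"])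
  qed
  show False
  proof (cases "emeasure lebesgue V = 0")
    case True
    then have "(\<Union>q\<in>\<rat>. (+) q ` V) \<in> null_sets lebesgue"
      using trans trans_sets countable_rat by (intro null_sets_UN') auto
    then show False unfolding cov[symmetric] by (auto simp: null_sets_def)
  next
    case False
    have fin: "emeasure lebesgue V \<le> ennreal c"
      using emeasure_mono[OF V(2), of lebesgue] assms by simp
    have "infinite (\<rat> \<inter> {0..1::real})"
    proof -
      have "inj (\<lambda>n::nat. 1 / (1 + real n))" by (auto intro!: injI)
      then have "infinite (range (\<lambda>n::nat. 1 / (1 + real n)))" by (simp add: finite_image_iff)
      moreover have "range (\<lambda>n::nat. 1 / (1 + real n)) \<subseteq> \<rat> \<inter> {0..1}" by auto
      ultimately show ?thesis using finite_subset by blast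
    qed
    define m where "m = measure lebesgue V"
    have m: "emeasure lebesgue V = ennreal m"
      unfolding m_def using fin by (intro emeasure_eq_ennreal_measure) (auto simp: top_unique)
    have "0 < m" using False m by (metis ennreal_0 measure_nonneg m_def less_eq_real_def)
    obtain n :: nat where n: "c + 1 < n * m" using reals_Archimedean3[OF \<open>0 < m\<close>] by blast
    obtain F where F: "F \<subseteq> \<rat> \<inter> {0..1::real}" "card F = n" "finite F"
      using infinite_arbitrarily_large[OF \<open>infinite (\<rat> \<inter> {0..1::real})\<close>] by blast
    have "ennreal (n * m) = (\<Sum>q\<in>F. emeasure lebesgue ((+) q ` V))"
      using F m by (simp add: trans ennreal_mult ennreal_of_nat_eq_real_of_nat m_def)
    also have "\<dots> = emeasure lebesgue (\<Union>q\<in>F. (+) q ` V)"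
      using F disj trans_sets by (intro sum_emeasure disjoint_family_on_mono[of F \<rat>]) auto
    also have "\<dots> \<le> emeasure lebesgue {0..c + 1}"
      using F V(2) by (intro emeasure_mono) (force+)
    also have "\<dots> = ennreal (c + 1)" using assms by simp
    finally show False using n assms by (simp add: ennreal_le_iff del: ennreal_plus)
  qed
qed

text \<open>For each basic open set \<open>B n\<close>, its preimage \<open>A n\<close> and the rest
  of \<open>S\<close> are approximated from inside by closed sets \<open>F n\<close> and
  \<open>G n\<close>, with loss e / 2^(n+1). A point of \<open>C\<close> outside the closed set
  \<open>G n\<close> must lie in \<open>F n\<close>, so the preimage of \<open>B n\<close> is
  relatively open in \<open>C\<close>. The losses sum to \<open>e\<close>.\<close>

lemma lusin:
  fixes f :: "real \<Rightarrow> real"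
  assumes S: "S \<in> sets lebesgue" and f: "f \<in> borel_measurable (lebesgue_on S)" and "0 < e"
  obtains C where "closed C" "C \<subseteq> S" "continuous_on C f" "emeasure lebesgue (S - C) \<le> ennreal e"
proof -
  obtain \<B> :: "real set set" where \<B>: "countable \<B>" "topological_basis \<B>" using ex_countable_basis by blast
  have "\<B> \<noteq> {}" using topological_basisE[OF \<B>(2) open_UNIV UNIV_I] by blast
  define B where "B = from_nat_into \<B>"
  have B: "topological_basis (range B)"
    using \<B> \<open>\<B> \<noteq> {}\<close> by (simp add: B_def range_from_nat_into)
  define A where "A n = {t \<in> S. f t \<in> B n}" for n
  have A: "A n \<in> sets lebesgue" for n
  proof -
    have "B n \<in> sets borel" using topological_basis_open[OF B] by auto
    then have "f -` B n \<inter> space (lebesgue_on S) \<in> sets (lebesgue_on S)" using f by (rule measurable_sets[rotated])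
    moreover have "f -` B n \<inter> space (lebesgue_on S) = A n" by (auto simp: A_def)
    ultimately show ?thesis using S by (simp add: sets_restrict_space_iff)
  qed
  have "\<exists>F G. closed F \<and> F \<subseteq> A n \<and> closed G \<and> G \<subseteq> S - A n \<and>
     emeasure lebesgue (S - (F \<union> G)) \<le> ennreal (e * (1/2)^Suc n)" for n
  proof -
    have e: "0 < e * (1/2)^Suc n / 2" using \<open>0 < e\<close> by simp
    obtain F where F: "closed F" "F \<subseteq> A n" "A n - F \<in> lmeasurable"
        "emeasure lebesgue (A n - F) < ennreal (e * (1/2)^Suc n / 2)"
      using sets_lebesgue_inner_closed[OF A e] by blast
    have "S - A n \<in> sets lebesgue" using S A by blast
    from sets_lebesgue_inner_closed[OF this e]
    obtain G where G: "closed G" "G \<subseteq> S - A n" "(S - A n) - G \<in> lmeasurable"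
        "emeasure lebesgue ((S - A n) - G) < ennreal (e * (1/2)^Suc n / 2)" by blast
    have "emeasure lebesgue (S - (F \<union> G)) \<le> emeasure lebesgue ((A n - F) \<union> ((S - A n) - G))"
      using F G by (intro emeasure_mono) auto
    also have "\<dots> \<le> emeasure lebesgue (A n - F) + emeasure lebesgue ((S - A n) - G)"
      using F G by (intro emeasure_subadditive) auto
    also have "\<dots> \<le> ennreal (e * (1/2)^Suc n / 2) + ennreal (e * (1/2)^Suc n / 2)"
      using F(4) G(4) by (intro add_mono) auto
    also have "\<dots> = ennreal (e * (1/2)^Suc n)" using e by (subst ennreal_plus[symmetric]) auto
    finally show ?thesis using F G by blast
  qed
  then obtain F G where F: "\<And>n. closed (F n)" "\<And>n. F n \<subseteq> A n" and G: "\<And>n. closed (G n)" "\<And>n. G n \<subseteq> S - A n"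
    and FG: "\<And>n. emeasure lebesgue (S - (F n \<union> G n)) \<le> ennreal (e * (1/2)^Suc n)" by metis
  define C where "C = (\<Inter>n. F n \<union> G n)"
  have "closed C" unfolding C_def using F G by (intro closed_INT ballI closed_Un) auto
  moreover have "C \<subseteq> S" using F(2)[of 0] G(2)[of 0] by (auto simp: C_def A_def)
  moreover have "continuous_on C f"
    unfolding continuous_on_topological
  proof (intro ballI allI impI)
    fix x W assume x: "x \<in> C" and W: "open W" "f x \<in> W"
    then obtain n where n: "f x \<in> B n" "B n \<subseteq> W" using topological_basisE[OF B] by (metis imageE)
    have "x \<in> A n" using n x \<open>C \<subseteq> S\<close> by (auto simp: A_def)
    then have "x \<notin> G n" using G(2)[of n] by auto
    moreover have "f y \<in> W" if "y \<in> C" "y \<notin> G n" for y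
    proof -
      have "y \<in> F n" using that by (auto simp: C_def)
      then show ?thesis using F(2)[of n] n by (auto simp: A_def)
    qed
    ultimately show "\<exists>X. open X \<and> x \<in> X \<and> (\<forall>y\<in>C. y \<in> X \<longrightarrow> f y \<in> W)"
      using G(1)[of n] by (intro exI[of _ "- G n"]) auto
  qed
  moreover have "emeasure lebesgue (S - C) \<le> ennreal e"
  proof -
    have "emeasure lebesgue (S - C) = emeasure lebesgue (\<Union>n. S - (F n \<union> G n))" by (simp add: C_def)
    also have "\<dots> \<le> (\<Sum>n. emeasure lebesgue (S - (F n \<union> G n)))"
      using S F G by (intro emeasure_subadditive_countably) (auto intro!: sets.Diff)
    also have "\<dots> \<le> (\<Sum>n. ennreal (e * (1/2)^Suc n))"
      using FG by (intro suminf_le) auto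
    also have "\<dots> = ennreal e"
    proof (rule suminf_ennreal_eq)
      show "(\<lambda>n. e * (1/2)^Suc n) sums e" using sums_mult[OF power_half_series, of e] by simp
    qed (use \<open>0 < e\<close> in auto)
    finally show ?thesis .
  qed
  ultimately show thesis by (rule that)
qed

text \<open>
  Composing \<open>p\<close> with its continuous distribution function \<open>F\<close> gives a map \<open>q\<close> that carries Lebesgue
  measure on \<open>S\<close> to Lebesgue measure on \<open>{0..c}\<close>. By Lusin's theorem preimages under \<open>q\<close> can be
  approximated from inside by compact sets with compact images, so every subset of \<open>{0..c}\<close> would
  be measurable.
\<close>
lemma null_fibred_null:
  fixes p :: "real \<Rightarrow> real"
  assumes S: "S \<in> sets lebesgue" "S \<subseteq> {a..b}"
    and all: "\<And>A. {t \<in> S. p t \<in> A} \<in> sets lebesgue"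
    and fib: "\<And>x. emeasure lebesgue {t \<in> S. p t = x} = 0"
  shows "emeasure lebesgue S = 0"
proof (rule ccontr)
  assume "emeasure lebesgue S \<noteq> 0"
  define M where "M = lebesgue_on S"
  define c where "c = measure lebesgue S"
  have "emeasure lebesgue S \<le> emeasure lebesgue {a..b}" using S by (intro emeasure_mono) auto
  then have fin: "emeasure lebesgue S < \<infinity>" by (rule le_less_trans) (simp add: emeasure_lborel_Icc_eq)
  then have S_l: "S \<in> lmeasurable" using S by (simp add: fmeasurable_def)
  have c: "emeasure lebesgue S = ennreal c" unfolding c_def using fin by (simp add: emeasure_eq_ennreal_measure)
  then have "0 < c" using \<open>emeasure lebesgue S \<noteq> 0\<close>
    by (metis c_def ennreal_0 measure_nonneg less_eq_real_def)
  have M: "space M = S" "finite_measure M" using fin S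
    by (auto simp: M_def emeasure_restrict_space intro!: finite_measureI)
  have meas: "(\<lambda>t. g (p t)) \<in> borel_measurable M" for g :: "real \<Rightarrow> real"
  proof (rule measurableI)
    fix A :: "real set"
    have "(\<lambda>t. g (p t)) -` A \<inter> space M = {t \<in> S. p t \<in> g -` A}" using M by auto
    then show "(\<lambda>t. g (p t)) -` A \<inter> space M \<in> sets M"
      using all[of "g -` A"] S by (auto simp: M_def sets_restrict_space_iff)
  qed auto
  have distr_gp: "measure (distr M borel (\<lambda>t. g (p t))) B = measure lebesgue {t \<in> S. g (p t) \<in> B}"
    if "B \<in> sets borel" for B and g :: "real \<Rightarrow> real"
  proof -
    have "measure (distr M borel (\<lambda>t. g (p t))) B = measure M {t \<in> S. g (p t) \<in> B}"
      using that meas M(1) by (simp add: measure_distr vimage_def Int_def conj_commute)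
    also have "\<dots> = measure lebesgue {t \<in> S. g (p t) \<in> B}"
      using S unfolding M_def by (intro measure_restrict_space) auto
    finally show ?thesis .
  qed
  have fb: "finite_borel_measure (distr M borel (\<lambda>t. g (p t)))" for g :: "real \<Rightarrow> real"
    using finite_measure.finite_measure_distr[OF M(2) meas] by (auto simp: finite_borel_measure_def finite_borel_measure_axioms_def)
  define \<nu> where "\<nu> = distr M borel p"
  interpret \<nu>: finite_borel_measure \<nu> using fb[of "\<lambda>x. x"] by (simp add: \<nu>_def)
  have \<nu>: "measure \<nu> B = measure lebesgue {t \<in> S. p t \<in> B}" if "B \<in> sets borel" for B
    using distr_gp[OF that, of "\<lambda>x. x"] by (simp add: \<nu>_def)
  define F where "F = cdf \<nu>"
  have "measure lebesgue {t \<in> S. p t = x} = 0" for x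
    using fib[of x] by (simp add: measure_def)
  then have F_cont: "isCont F x" for x
    unfolding F_def \<nu>.isCont_cdf by (simp add: \<nu>)
  have tot: "measure \<nu> (space \<nu>) = c" by (simp add: \<nu> \<nu>.borel_UNIV c_def)
  have F_range: "0 \<le> F x" "F x \<le> c" for x
    using \<nu>.cdf_nonneg \<nu>.cdf_bounded tot by (auto simp: F_def)
  have F_mono: "F x \<le> F y" if "x \<le> y" for x y using \<nu>.cdf_nondecreasing[OF that] by (simp add: F_def)
  define q where "q = (\<lambda>t. F (p t))"
  define \<rho> where "\<rho> = distr M borel q"
  define \<eta> where "\<eta> = distr (lebesgue_on {0..c}) borel (\<lambda>x. x)"
  have id: "(\<lambda>x. x) \<in> borel_measurable (lebesgue_on {0..c})" by (intro measurable_restrict_space1 measurable_completion) simp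
  have \<eta>: "measure \<eta> B = measure lebesgue (B \<inter> {0..c})" if B: "B \<in> sets borel" for B
  proof -
    have "measure \<eta> B = measure (lebesgue_on {0..c}) (B \<inter> {0..c})"
      unfolding \<eta>_def using B id by (simp add: measure_distr)
    also have "\<dots> = measure lebesgue (B \<inter> {0..c})" by (intro measure_restrict_space) auto
    finally show ?thesis .
  qed
  have \<rho>: "measure \<rho> B = measure lebesgue {t \<in> S. q t \<in> B}" if "B \<in> sets borel" for B
    using distr_gp[OF that, of F] by (simp add: \<rho>_def q_def)
  have "\<rho> = \<eta>"
  proof (rule cdf_unique')
    show "finite_borel_measure \<rho>" using fb[of F] by (simp add: \<rho>_def q_def)
    have "finite_measure (lebesgue_on {0..c})"
      by (intro finite_measureI) (simp add: emeasure_restrict_space emeasure_lborel_Icc_eq)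
    from finite_measure.finite_measure_distr[OF this id] show "finite_borel_measure \<eta>"
      by (auto simp: finite_borel_measure_def finite_borel_measure_axioms_def \<eta>_def)
    show "cdf \<rho> = cdf \<eta>"
    proof
      fix y
      have L: "cdf \<rho> y = measure lebesgue {t \<in> S. q t \<le> y}" by (simp add: cdf_def \<rho>)
      have R: "cdf \<eta> y = measure lebesgue ({..y} \<inter> {0..c})" by (simp add: cdf_def \<eta>)
      consider "y < 0" | "c \<le> y" | "0 \<le> y" "y < c" by linarith
      then show "cdf \<rho> y = cdf \<eta> y"
      proof cases
        case 1
        then have e: "{t \<in> S. q t \<le> y} = {}" "{..y} \<inter> {0..c} = {}" using F_range by (auto simp: q_def not_le intro: less_le_trans)
        show ?thesis unfolding L R e by simp
      next
        case 2
        then have e: "{t \<in> S. q t \<le> y} = S" "{..y} \<inter> {0..c} = {0..c}" using F_range(2) order_trans by (auto simp: q_def)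
        show ?thesis unfolding L R e using \<open>0 < c\<close> by (simp add: c_def)
      next
        case 3
        \<comment> \<open>\<open>F\<close> need not be strictly increasing, so the level
          \<open>y\<close> is reached through the largest point \<open>s\<close> of the sublevel
          set. The intermediate value theorem gives F s = y, and then q t <= y means p t <= s, an
          event of measure F s. An empty sublevel set forces y = 0, because \<open>F\<close> tends
          to 0 at minus infinity.\<close>
        define X where "X = {x. F x \<le> y}"
        have "closed X" unfolding X_def using F_cont by (intro closed_Collect_le) (auto simp: continuous_on_eq_continuous_at)
        have "(F \<longlongrightarrow> c) at_top" using \<nu>.cdf_lim_at_top tot by (simp add: F_def)
        then have "eventually (\<lambda>x. y < F x) at_top" using 3 by (intro order_tendstoD)
        then obtain x0 where x0: "\<And>x. x0 \<le> x \<Longrightarrow> y < F x" by (auto simp: eventually_at_top_linorder)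
        have bdd: "bdd_above X" using x0 by (intro bdd_aboveI[of _ x0]) (metis X_def linorder_linear mem_Collect_eq not_le)
        have "{..y} \<inter> {0..c} = {0..y}" using 3 by auto
        then have R': "cdf \<eta> y = y" using 3 by (simp add: R)
        have "measure lebesgue {t \<in> S. q t \<le> y} = y"
        proof (cases "X = {}")
          case True
          have "(F \<longlongrightarrow> 0) at_bot" using \<nu>.cdf_lim_at_bot by (simp add: F_def)
          then have "eventually (\<lambda>x. F x < y) at_bot" if "0 < y" using that by (intro order_tendstoD)
          then have "\<not> 0 < y" using True eventually_happens[of "\<lambda>x. F x < y" at_bot] by (auto simp: X_def intro: less_imp_le)
          moreover have e: "{t \<in> S. q t \<le> y} = {}" using True by (auto simp: X_def q_def)
          ultimately show ?thesis unfolding e using 3 by simp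
        next
          case False
          define s where "s = Sup X"
          have s: "s \<in> X" unfolding s_def using False bdd \<open>closed X\<close> by (intro closed_contains_Sup)
          have s_ub: "x \<le> s" if "x \<in> X" for x unfolding s_def using that bdd by (rule cSup_upper)
          have "s \<le> x0" using s x0[of s] by (force simp: X_def)
          have "\<exists>z\<ge>s. z \<le> x0 \<and> F z = y"
            using s x0[of x0] F_cont \<open>s \<le> x0\<close> by (intro IVT') (auto simp: X_def continuous_on_eq_continuous_at intro!: continuous_at_imp_continuous_on)
          then obtain z where z: "s \<le> z" "F z = y" by blast
          then have "z = s" using s_ub[of z] by (simp add: X_def)
          then have "F s = y" using z by simp
          have "{t \<in> S. q t \<le> y} = {t \<in> S. p t \<in> {..s}}"
            using s_ub F_mono[of _ s] \<open>F s = y\<close> by (auto simp: q_def X_def)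
          then show ?thesis using \<nu>[of "{..s}"] \<open>F s = y\<close> by (simp add: F_def cdf_def)
        qed
        then show ?thesis by (simp add: L R')
      qed
    qed
  qed
  have q_all: "{t \<in> S. q t \<in> A} \<in> lmeasurable" for A
  proof -
    have "{t \<in> S. q t \<in> A} = {t \<in> S. p t \<in> F -` A}" by (auto simp: q_def)
    then have "{t \<in> S. q t \<in> A} \<in> sets lebesgue" using all[of "F -` A"] by simp
    then show ?thesis by (rule fmeasurableI2[OF S_l, rotated]) auto
  qed
  have inner: "\<exists>K \<subseteq> A. compact K \<and> measure lebesgue {t \<in> S. q t \<in> A} - e \<le> measure lebesgue K"
    if A: "A \<subseteq> {0..c}" and e: "0 < e" for A e
  proof -
    let ?E = "{t \<in> S. q t \<in> A}"
    have E: "?E \<in> sets lebesgue" using q_all by blast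
    have "q \<in> borel_measurable (lebesgue_on ?E)"
      using meas[of F] E S unfolding M_def q_def
      by (rule_tac measurable_restrict_mono) (auto simp: q_def)
    from lusin[OF E this e] obtain C where C: "closed C" "C \<subseteq> ?E" "continuous_on C q"
      "emeasure lebesgue (?E - C) \<le> ennreal e" by blast
    have "C \<subseteq> {a..b}" using C S by auto
    then have "compact C" using C(1) compact_Icc[of a b] by (metis closed_Int_compact Int_absorb2)
    then have K: "compact (q ` C)" using C by (intro compact_continuous_image)
    have Cm: "C \<in> lmeasurable" using \<open>compact C\<close> by (rule lmeasurable_compact)
    have "measure lebesgue ?E - measure lebesgue C = measure lebesgue (?E - C)"
      using q_all Cm C(2) by (intro measurable_measure_Diff[symmetric]) auto
    also have "\<dots> \<le> e" using C(4) e by (simp add: measure_def enn2real_leI)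
    finally have 1: "measure lebesgue ?E - e \<le> measure lebesgue C" by simp
    \<comment> \<open>The compact image of \<open>C\<close> has the same Lebesgue measure as its
      whole preimage in \<open>S\<close>, and that preimage contains \<open>C\<close>.\<close>
    have "measure lebesgue C \<le> measure lebesgue {t \<in> S. q t \<in> q ` C}"
      using C q_all Cm by (intro measure_mono_fmeasurable) auto
    also have "\<dots> = measure \<rho> (q ` C)" using K by (intro \<rho>[symmetric]) (simp add: borel_compact)
    also have "\<dots> = measure lebesgue (q ` C \<inter> {0..c})" unfolding \<open>\<rho> = \<eta>\<close> using K by (intro \<eta>) (simp add: borel_compact)
    also have "q ` C \<inter> {0..c} = q ` C" using C(2) A by auto
    finally show ?thesis using 1 K C(2) by (intro exI[of _ "q ` C"]) auto
  qed
  obtain A where A: "A \<subseteq> {0..c}" "A \<notin> sets lebesgue" using ex_nonmeasurable_subset[OF \<open>0 < c\<close>] by blast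
  \<comment> \<open>An inner approximation \<open>K'\<close> of the complement in {0..c} is an outer
    approximation of \<open>A\<close>. Two errors of e/3 leave a gap of at most 2e/3, which is below
    \<open>e\<close>.\<close>
  have "A \<in> lmeasurable"
    unfolding completion.fmeasurable_inner_outer
  proof (intro allI impI)
    fix e :: real assume "0 < e"
    then have e: "0 < e / 3" by simp
    let ?A' = "{0..c} - A"
    obtain K where K: "K \<subseteq> A" "compact K" "measure lebesgue {t \<in> S. q t \<in> A} - e / 3 \<le> measure lebesgue K"
      using inner[OF A(1) e] by blast
    obtain K' where K': "K' \<subseteq> ?A'" "compact K'" "measure lebesgue {t \<in> S. q t \<in> ?A'} - e / 3 \<le> measure lebesgue K'"
      using inner[OF Diff_subset e] by blast
    have Km: "K \<in> lmeasurable" "K' \<in> lmeasurable" using K(2) K'(2) by (auto intro: lmeasurable_compact)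
    have "S = {t \<in> S. q t \<in> A} \<union> {t \<in> S. q t \<in> ?A'}" using F_range by (auto simp: q_def)
    then have "c = measure lebesgue ({t \<in> S. q t \<in> A} \<union> {t \<in> S. q t \<in> ?A'})" by (simp add: c_def)
    also have "\<dots> = measure lebesgue {t \<in> S. q t \<in> A} + measure lebesgue {t \<in> S. q t \<in> ?A'}"
      by (rule measure_Union[OF fmeasurableD2[OF q_all, folded infinity_ennreal_def]
          fmeasurableD2[OF q_all, folded infinity_ennreal_def] fmeasurableD[OF q_all] fmeasurableD[OF q_all]]) blast
    finally have "c - 2 * e / 3 \<le> measure lebesgue K + measure lebesgue K'" using K(3) K'(3) by simp
    moreover have "measure lebesgue ({0..c} - K') = c - measure lebesgue K'"
      using K' Km \<open>0 < c\<close> by (subst measurable_measure_Diff) auto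
    moreover have "measure lebesgue K \<le> measure lebesgue ({0..c} - K')"
      using K K' A Km by (intro measure_mono_fmeasurable) auto
    ultimately have "\<bar>measure lebesgue K - measure lebesgue ({0..c} - K')\<bar> < e" using \<open>0 < e\<close> by linarith
    moreover have "{0..c} - K' \<in> lmeasurable" using Km by (intro fmeasurable_Diff) auto
    moreover have "A \<subseteq> {0..c} - K'" using A K' by auto
    ultimately show "\<exists>T\<in>lmeasurable. \<exists>U\<in>lmeasurable. T \<subseteq> A \<and> A \<subseteq> U \<and> \<bar>measure lebesgue T - measure lebesgue U\<bar> < e"
      using K Km by blast
  qed
  then show False using A by blast
qed

text \<open>
  Labelling each set by one of its points turns the family into a map \<open>H\<close> with finite sets of reals as
  values, and its minimum \<open>p\<close> has null fibres. On the set \<open>S c\<close> where \<open>p t\<close> is the only element of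
  \<open>H t\<close> below \<open>c\<close>, all preimages under \<open>p\<close> are measurable.
\<close>
lemma point_finite_null_union:
  fixes N :: "'i \<Rightarrow> real set"
  assumes union: "\<And>A. A \<subseteq> I \<Longrightarrow> (\<Union>i\<in>A. N i) \<in> sets lebesgue"
    and null: "\<And>i. i \<in> I \<Longrightarrow> N i \<in> null_sets lebesgue"
    and bounded: "\<And>i. i \<in> I \<Longrightarrow> N i \<subseteq> {a..b}"
    and point_finite: "\<And>t. finite {i\<in>I. t \<in> N i}"
  shows "(\<Union>i\<in>I. N i) \<in> null_sets lebesgue"
proof -
  define I0 where "I0 = {i \<in> I. N i \<noteq> {}}"
  define j where "j i = (SOME t. t \<in> N i)" for i
  have j: "j i \<in> N i" if "i \<in> I0" for i
    using that by (auto simp: j_def I0_def some_in_eq)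
  define H where "H t = j ` {i \<in> I0. t \<in> N i}" for t
  have H_fin: "finite (H t)" for t
    unfolding H_def by (intro finite_imageI finite_subset[OF _ point_finite[of t]]) (auto simp: I0_def)
  define hit where "hit A = {t. H t \<inter> A \<noteq> {}}" for A
  have hit_eq: "hit A = (\<Union>i\<in>{i\<in>I0. j i \<in> A}. N i)" for A by (auto simp: hit_def H_def)
  have hit: "hit A \<in> sets lebesgue" for A unfolding hit_eq by (rule union) (auto simp: I0_def)
  have hit_sub: "hit A \<subseteq> {a..b}" for A unfolding hit_eq using bounded by (auto simp: I0_def)
  have hit_null: "hit {x} \<in> null_sets lebesgue" for x
  proof -
    \<comment> \<open>The labelling need not be injective, but an index with label \<open>x\<close>
      has \<open>x\<close> in its set, and point-finiteness allows only finitely many such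
      indices.\<close>
    have "{i\<in>I0. j i \<in> {x}} \<subseteq> {i\<in>I. x \<in> N i}" using j by (auto simp: I0_def)
    then have "finite {i\<in>I0. j i \<in> {x}}" using point_finite finite_subset by blast
    then show ?thesis unfolding hit_eq using null by (intro null_sets.finite_UN) (auto simp: I0_def)
  qed
  define p where "p t = Min (H t)" for t
  \<comment> \<open>Two distinct elements of \<open>H t\<close> below \<open>c\<close> are separated
    by a rational \<open>q\<close>. Removing countably many sets therefore suffices, which keeps
    \<open>S c\<close> measurable.\<close>
  define S where "S c = hit {..<c} - (\<Union>q\<in>\<rat>. hit {..<q} \<inter> hit {q..<c})" for c
  have S_sets: "S c \<in> sets lebesgue" for c
    unfolding S_def using hit countable_rat by (intro sets.Diff sets.countable_UN'') auto
  have S: "H t \<inter> {..<c} = {p t}" if t: "t \<in> S c" for t c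
  proof -
    obtain h where h: "h \<in> H t" "h < c" using t by (auto simp: S_def hit_def)
    have p: "p t \<in> H t" "p t \<le> h'" if "h' \<in> H t" for h'
      using that H_fin by (auto simp: p_def intro!: Min_in)
    have "h' = p t" if h': "h' \<in> H t" "h' < c" for h'
    proof (rule ccontr)
      assume "h' \<noteq> p t"
      then obtain q where q: "q \<in> \<rat>" "p t < q" "q < h'" using p[OF h'(1)] Rats_dense_in_real[of "p t" h'] by auto
      then have "t \<in> hit {..<q} \<inter> hit {q..<c}" using p[OF h'(1)] h' by (force simp: hit_def)
      then show False using t q by (auto simp: S_def)
    qed
    moreover have "p t < c" using p[OF h(1)] h(2) by linarith
    ultimately show ?thesis using p(1)[OF h(1)] by blast
  qed
  have "S c \<in> null_sets lebesgue" for c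
  proof -
    have "emeasure lebesgue (S c) = 0"
    proof (rule null_fibred_null)
      show "S c \<in> sets lebesgue" by (rule S_sets)
      show "S c \<subseteq> {a..b}" using hit_sub by (auto simp: S_def)
      show "{t \<in> S c. p t \<in> A} \<in> sets lebesgue" for A
      proof -
        have "H t \<inter> (A \<inter> {..<c}) = A \<inter> {p t}" if "t \<in> S c" for t using S[OF that] by blast
        then have "H t \<inter> (A \<inter> {..<c}) \<noteq> {} \<longleftrightarrow> p t \<in> A" if "t \<in> S c" for t using that by simp
        \<comment> \<open>On \<open>S c\<close> the set \<open>H t\<close> restricted to values
          below \<open>c\<close> is a singleton, so hitting by the set-valued map becomes membership
          of \<open>p t\<close>.\<close>
        then have "{t \<in> S c. p t \<in> A} = S c \<inter> hit (A \<inter> {..<c})" unfolding hit_def by blast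
        then show ?thesis using S_sets hit by auto
      qed
      show "emeasure lebesgue {t \<in> S c. p t = x} = 0" for x
      proof -
        have "p t \<in> H t" if "t \<in> S c" for t using S[OF that] by blast
        then have "{t \<in> S c. p t = x} \<subseteq> hit {x}" by (auto simp: hit_def)
        then have "{t \<in> S c. p t = x} \<in> null_sets lebesgue" using hit_null completion.complete2 by blast
        then show ?thesis by auto
      qed
    qed
    then show ?thesis using S_sets by auto
  qed
  then have "(\<Union>c\<in>\<rat>. S c) \<in> null_sets lebesgue" using countable_rat by (intro null_sets_UN')
  moreover have "(\<Union>i\<in>I. N i) \<subseteq> (\<Union>c\<in>\<rat>. S c)"
  proof
    fix t assume "t \<in> (\<Union>i\<in>I. N i)"
    then have "H t \<noteq> {}" by (auto simp: H_def I0_def)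
    then have p: "p t \<in> H t" "\<And>h. h \<in> H t \<Longrightarrow> p t \<le> h" using H_fin by (auto simp: p_def)
    \<comment> \<open>The second smallest element of \<open>H t\<close>; the inserted p t + 1 keeps
      the minimum meaningful when there is no second element.\<close>
    define m where "m = Min (insert (p t + 1) (H t - {p t}))"
    have "p t < h" if "h \<in> H t - {p t}" for h using p(2)[of h] that by auto
    then have m: "p t < m" "\<And>h. h \<in> H t \<Longrightarrow> h \<noteq> p t \<Longrightarrow> m \<le> h"
      unfolding m_def using H_fin[of t] by (auto simp del: Min_insert)
    obtain c where c: "c \<in> \<rat>" "p t < c" "c < m" using Rats_dense_in_real[OF m(1)] by blast
    have Hc: "h = p t" if "h \<in> H t" "h < c" for h using m(2)[OF that(1)] that c by fastforce
    have "t \<in> hit {..<c}" using p c by (auto simp: hit_def)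
    moreover have "t \<notin> hit {..<q} \<inter> hit {q..<c}" for q
      using Hc p(2) by (fastforce simp: hit_def)
    ultimately show "t \<in> (\<Union>c\<in>\<rat>. S c)" using c by (auto simp: S_def)
  qed
  ultimately show ?thesis using completion.complete2 by blast
qed

text \<open>If infinitely many sets had measure at least \<open>e\<close>, the limit superior of a
  sequence of them would also have measure at least \<open>e\<close> by continuity from above. A
  point of it would lie in infinitely many of the sets.\<close>

lemma (in finite_measure) countable_nonnull_point_finite:
  assumes sets: "\<And>i. i \<in> I \<Longrightarrow> N i \<in> sets M"
    and point_finite: "\<And>t. t \<in> space M \<Longrightarrow> finite {i\<in>I. t \<in> N i}"
  shows "countable {i\<in>I. 0 < measure M (N i)}"
proof -
  have "finite {i\<in>I. e \<le> measure M (N i)}" if "0 < e" for e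
  proof (rule ccontr)
    assume "infinite {i\<in>I. e \<le> measure M (N i)}"
    then obtain f :: "nat \<Rightarrow> _" where f: "inj f" "range f \<subseteq> {i\<in>I. e \<le> measure M (N i)}"
      using infinite_countable_subset by blast
    define L where "L n = (\<Union>k\<in>{n..}. N (f k))" for n
    have L: "range L \<subseteq> sets M" using sets f unfolding L_def by (intro image_subsetI sets.countable_UN'') auto
    have "decseq L" unfolding L_def decseq_def by (intro allI impI UN_mono) auto
    have "e \<le> measure M (\<Inter>n. L n)"
    proof (rule LIMSEQ_le_const[OF finite_Lim_measure_decseq[OF L \<open>decseq L\<close>]], intro exI allI impI)
      fix n
      have "e \<le> measure M (N (f n))" using f by auto
      also have "\<dots> \<le> measure M (L n)" using L by (intro finite_measure_mono) (auto simp: L_def)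
      finally show "e \<le> measure M (L n)" .
    qed
    then have "(\<Inter>n. L n) \<noteq> {}" using \<open>0 < e\<close> by auto
    then obtain t where t: "\<And>n. t \<in> L n" by auto
    then have "t \<in> space M" using L sets.sets_into_space by blast
    have "infinite {k. t \<in> N (f k)}"
      unfolding infinite_nat_iff_unbounded_le using t by (force simp: L_def)
    then have "infinite (f ` {k. t \<in> N (f k)})" using f(1) by (metis finite_imageD inj_on_subset subset_UNIV)
    moreover have "f ` {k. t \<in> N (f k)} \<subseteq> {i\<in>I. t \<in> N i}" using f by auto
    ultimately show False using point_finite[OF \<open>t \<in> space M\<close>] finite_subset by blast
  qed
  then have "countable (\<Union>n. {i\<in>I. 1 / Suc n \<le> measure M (N i)})"
    by (intro countable_UN) (auto intro: countable_finite)
  moreover have "{i\<in>I. 0 < measure M (N i)} \<subseteq> (\<Union>n. {i\<in>I. 1 / Suc n \<le> measure M (N i)})"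
    using nat_approx_posE less_imp_le by (smt (verit) UN_iff UNIV_I mem_Collect_eq subsetI)
  ultimately show ?thesis by (rule countable_subset[rotated])
qed

section \<open>Compact-valued maps\<close>

lemma Inter_decreasing_compacts_nonempty:
  fixes F :: "nat \<Rightarrow> 'a::t2_space set"
  assumes "\<And>n. compact (F n)" "\<And>n. F n \<noteq> {}" "\<And>m n. m \<le> n \<Longrightarrow> F n \<subseteq> F m"
  shows "(\<Inter>n. F n) \<noteq> {}"
proof -
  have "F 0 \<inter> (\<Inter>n. F n) \<noteq> {}"
  proof (rule compact_imp_fip_image)
    fix I :: "nat set" assume "finite I"
    then have "F (Max (insert 0 I)) \<subseteq> F 0 \<inter> (\<Inter>n\<in>I. F n)"
      by (auto intro: set_mp[OF assms(3), rotated])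
    then show "F 0 \<inter> (\<Inter>n\<in>I. F n) \<noteq> {}" using assms(2) by blast
  qed (simp_all add: assms compact_imp_closed)
  then show ?thesis by blast
qed

text \<open>The distance to \<open>C\<close> attains its minimum on the compact set
  \<open>F t\<close>. Meeting every open neighbourhood \<open>W n\<close> of \<open>C\<close> makes
  this minimum 0, and the minimizer lies in \<open>C\<close>. The empty set is treated apart because
  \<open>infdist\<close> to it is 0 by convention.\<close>

lemma hit_closed_measurable:
  fixes F :: "'t \<Rightarrow> 'u::metric_space set"
  assumes compact: "\<And>t. t \<in> \<Omega> \<Longrightarrow> compact (F t)"
    and hit: "\<And>W. open W \<Longrightarrow> {t\<in>\<Omega>. F t \<inter> W \<noteq> {}} \<in> sets M"
    and "closed C"
  shows "{t\<in>\<Omega>. F t \<inter> C \<noteq> {}} \<in> sets M"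
proof (cases "C = {}")
  case False
  define W where "W n = {x. infdist x C < 1 / Suc n}" for n
  have W: "open (W n)" for n unfolding W_def by (intro open_Collect_less continuous_intros)
  have "{t\<in>\<Omega>. F t \<inter> C \<noteq> {}} = (\<Inter>n. {t\<in>\<Omega>. F t \<inter> W n \<noteq> {}})"
  proof (intro equalityI subsetI)
    fix t assume t: "t \<in> (\<Inter>n. {t\<in>\<Omega>. F t \<inter> W n \<noteq> {}})"
    then have "t \<in> \<Omega>" "F t \<noteq> {}" by auto
    moreover have "continuous_on (F t) (\<lambda>x. infdist x C)" by (intro continuous_intros)
    ultimately obtain x where x: "x \<in> F t" "\<And>y. y \<in> F t \<Longrightarrow> infdist x C \<le> infdist y C"
      using continuous_attains_inf[OF compact] by meson
    have "infdist x C \<le> 1 / Suc n" for n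
    proof -
      obtain y where "y \<in> F t" "infdist y C < 1 / Suc n" using t by (auto simp: W_def)
      then show ?thesis using x(2)[of y] by linarith
    qed
    then have "infdist x C \<le> 0" using nat_approx_posE by (metis not_le)
    then have "x \<in> C" using \<open>closed C\<close> False infdist_nonneg[of x C] by (simp add: in_closed_iff_infdist_zero)
    then show "t \<in> {t\<in>\<Omega>. F t \<inter> C \<noteq> {}}" using x \<open>t \<in> \<Omega>\<close> by auto
  next
    fix t assume "t \<in> {t\<in>\<Omega>. F t \<inter> C \<noteq> {}}"
    then obtain x where "t \<in> \<Omega>" "x \<in> F t" "x \<in> C" by auto
    moreover have "x \<in> W n" for n using \<open>x \<in> C\<close> by (simp add: W_def)
    ultimately show "t \<in> (\<Inter>n. {t\<in>\<Omega>. F t \<inter> W n \<noteq> {}})" by auto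
  qed
  then show ?thesis using hit W by auto
qed auto

text \<open>
  The balls of radius \<open>e\<close> are made disjoint along a well-ordering of their centres; for fixed \<open>n\<close>, the
  shrunken pieces \<open>E n b\<close> have pairwise distance at least \<open>1 / Suc n\<close> (A. H. Stone's construction), so all
  their unions are closed and a compact set meets finitely many of them.
\<close>
lemma setmap_ess_separable:
  fixes F :: "real \<Rightarrow> 'u::metric_space set"
  assumes meas: "setmap_measurable T F" and compact: "\<And>t. t \<in> {0..T} \<Longrightarrow> compact (F t)"
  shows "\<exists>D. countable D \<and> (AE t in lebesgue_on {0..T}. F t \<subseteq> closure D)"
proof -
  define M where "M = lebesgue_on {0..T}"
  interpret M: finite_measure M
    unfolding M_def by (intro finite_measureI) (simp add: emeasure_restrict_space emeasure_lborel_Icc_eq)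
  have hit: "{t\<in>{0..T}. F t \<inter> C \<noteq> {}} \<in> sets lebesgue" if "closed C" for C
    by (rule hit_closed_measurable[OF compact _ that]) (use meas in \<open>simp_all add: setmap_measurable_def\<close>)
  obtain r :: "'u rel" where r: "well_order_on UNIV r" using well_order_on by blast
  define lt where "lt = r - Id"
  have wf: "wf lt" using r by (simp add: lt_def well_order_on_def)
  have total: "(b, c) \<in> lt \<or> (c, b) \<in> lt" if "b \<noteq> c" for b c
    using r that by (auto simp: lt_def well_order_on_def linear_order_on_def total_on_def)
  have "\<exists>J. countable J \<and> (AE t in M. F t \<subseteq> (\<Union>b\<in>J. ball b e))" if "0 < e" for e
  proof -
    have pos: "0 < 1 / real (Suc n)" for n by simp
    define E where "E n b = {x. ball x (1 / Suc n) \<subseteq> ball b e \<and> (\<forall>c. (c, b) \<in> lt \<longrightarrow> x \<notin> ball c e)}" for n b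
    have sep: "1 / Suc n \<le> dist x y" if "x \<in> E n b" "y \<in> E n c" "b \<noteq> c" for n x y b c
      using total[OF that(3)]
    proof
      assume "(b, c) \<in> lt"
      then have "y \<notin> ball b e" "ball x (1 / Suc n) \<subseteq> ball b e" using that by (auto simp: E_def)
      then have "y \<notin> ball x (1 / Suc n)" by blast
      then show ?thesis by simp
    next
      assume "(c, b) \<in> lt"
      then have "x \<notin> ball c e" "ball y (1 / Suc n) \<subseteq> ball c e" using that by (auto simp: E_def)
      then have "x \<notin> ball y (1 / Suc n)" by blast
      then show ?thesis by (simp add: dist_commute)
    qed
    have E_closed: "closed (E n b)" for n b
    proof -
      have "E n b = (\<Inter>y\<in>- ball b e. {x. 1 / Suc n \<le> dist x y}) \<inter> (\<Inter>c\<in>{c. (c, b) \<in> lt}. - ball c e)"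
        unfolding E_def subset_iff by (auto simp: not_less[symmetric])
      then show ?thesis by (auto intro!: closed_Int closed_INT closed_Collect_le continuous_intros)
    qed
    have E_Un_closed: "closed (\<Union>b\<in>A. E n b)" for n A
      unfolding closed_sequential_limits
    proof (intro allI impI, elim conjE)
      fix s l assume s: "\<forall>k. s k \<in> (\<Union>b\<in>A. E n b)" and l: "s \<longlonglongrightarrow> l"
      from LIMSEQ_imp_Cauchy[OF l] obtain K where K: "\<And>k. K \<le> k \<Longrightarrow> dist (s k) (s K) < 1 / Suc n"
        unfolding Cauchy_altdef2 by (meson pos)
      obtain b where b: "b \<in> A" "s K \<in> E n b" using s by auto
      \<comment> \<open>The tail of the sequence stays closer to \<open>s K\<close> than the gap
        between different pieces, so it remains in the piece of \<open>s K\<close>.\<close>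
      have "s (k + K) \<in> E n b" for k
      proof -
        obtain c where c: "c \<in> A" "s (k + K) \<in> E n c" using s by blast
        then show ?thesis using sep[OF c(2) b(2)] K[of "k + K"] by force
      qed
      then have "l \<in> E n b"
        by (rule closed_sequentially[OF E_closed _ LIMSEQ_ignore_initial_segment[OF l]])
      then show "l \<in> (\<Union>b\<in>A. E n b)" using b by auto
    qed
    define N where "N n b = {t\<in>{0..T}. F t \<inter> E n b \<noteq> {}}" for n b
    have N_sets: "N n b \<in> sets lebesgue" for n b unfolding N_def using E_closed by (rule hit)
    have N_sets': "N n b \<in> sets M" for n b
      using N_sets by (auto simp: M_def sets_restrict_space_iff N_def)
    have N_fin: "finite {b. t \<in> N n b}" if t: "t \<in> {0..T}" for t n
    proof -
      \<comment> \<open>The radius is half the gap between pieces, so each ball of the cover meets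
        at most one piece.\<close>
      obtain k where k: "finite k" "F t \<subseteq> (\<Union>x\<in>k. ball x (1 / Suc n / 2))"
        using compact[OF t] pos[of n] unfolding compact_eq_totally_bounded by (meson half_gt_zero)
      have "finite {b. E n b \<inter> ball x (1 / Suc n / 2) \<noteq> {}}" for x
      proof -
        have "b = c" if "y \<in> E n b" "y \<in> ball x (1 / Suc n / 2)" "z \<in> E n c" "z \<in> ball x (1 / Suc n / 2)" for b c y z
        proof (rule ccontr)
          assume "b \<noteq> c"
          from sep[OF that(1,3) this] have "1 / Suc n \<le> dist y z" .
          moreover have "dist y z < 1 / Suc n"
            using that(2,4) unfolding mem_ball by (rule dist_triangle_half_r)
          ultimately show False by simp
        qed
        then have "b = c" if "b \<in> {b. E n b \<inter> ball x (1 / Suc n / 2) \<noteq> {}}"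
            "c \<in> {b. E n b \<inter> ball x (1 / Suc n / 2) \<noteq> {}}" for b c
          using that by blast
        then have "{b. E n b \<inter> ball x (1 / Suc n / 2) \<noteq> {}} = {} \<or>
            (\<exists>c. {b. E n b \<inter> ball x (1 / Suc n / 2) \<noteq> {}} = {c})" by blast
        then show ?thesis by (elim disjE exE) simp_all
      qed
      then have "finite (\<Union>x\<in>k. {b. E n b \<inter> ball x (1 / Suc n / 2) \<noteq> {}})" using k by blast
      moreover have "{b. t \<in> N n b} \<subseteq> (\<Union>x\<in>k. {b. E n b \<inter> ball x (1 / Suc n / 2) \<noteq> {}})"
        using k(2) by (fastforce simp: N_def)
      ultimately show ?thesis using finite_subset by blast
    qed
    \<comment> \<open>The centres whose pieces are hit during a set of times of positive measure.
      They become the separable part; the other centres, however many, have a null union of hitting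
      times.\<close>
    define J where "J n = {b. 0 < measure M (N n b)}" for n
    have J: "countable (J n)" for n
      using M.countable_nonnull_point_finite[of UNIV "N n"] N_sets' N_fin by (auto simp: J_def M_def)
    have "(\<Union>b\<in>- J n. N n b) \<in> null_sets lebesgue" for n
    proof (rule point_finite_null_union)
      show "(\<Union>b\<in>A. N n b) \<in> sets lebesgue" for A
      proof -
        \<comment> \<open>A union of hitting sets is the hitting set of a union of pieces, and that
          union is closed for an arbitrary family of centres.\<close>
        have "(\<Union>b\<in>A. N n b) = {t\<in>{0..T}. F t \<inter> (\<Union>b\<in>A. E n b) \<noteq> {}}" by (auto simp: N_def)
        then show ?thesis using hit[OF E_Un_closed] by simp
      qed
      show "N n b \<in> null_sets lebesgue" if "b \<in> - J n" for b
      proof -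
        have "measure M (N n b) = 0" using that measure_nonneg[of M "N n b"] by (simp add: J_def not_less)
        then have "emeasure M (N n b) = 0" by (simp add: M.emeasure_eq_measure)
        moreover have "emeasure M (N n b) = emeasure lebesgue (N n b)"
          unfolding M_def by (rule emeasure_restrict_space) (auto simp: N_def)
        ultimately show ?thesis using N_sets[of n b] by (simp add: null_setsI)
      qed
      show "N n b \<subseteq> {0..T}" for b by (auto simp: N_def)
      show "finite {i \<in> - J n. t \<in> N n i}" for t
      proof (cases "t \<in> {0..T}")
        case True
        show ?thesis by (rule finite_subset[OF _ N_fin[OF True, of n]]) auto
      qed (auto simp: N_def)
    qed
    then have "(\<Union>n. \<Union>b\<in>- J n. N n b) \<in> null_sets lebesgue" by (intro null_sets_UN)
    then have "AE t in lebesgue. t \<notin> (\<Union>n. \<Union>b\<in>- J n. N n b)" by (rule AE_not_in)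
    then have "AE t in M. t \<notin> (\<Union>n. \<Union>b\<in>- J n. N n b)" unfolding M_def by (subst AE_restrict_space_iff) auto
    then have "AE t in M. F t \<subseteq> (\<Union>b\<in>(\<Union>n. J n). ball b e)"
    proof (rule AE_mp, intro AE_I2 impI subsetI)
      fix t x assume t: "t \<in> space M" "t \<notin> (\<Union>n. \<Union>b\<in>- J n. N n b)" and x: "x \<in> F t"
      \<comment> \<open>Every point belongs to the least centre \<open>b\<close> whose ball contains
        it: it lies in \<open>E n b\<close> as soon as 1 / (n + 1) is below its margin inside that
        ball.\<close>
      have "x \<in> {b. x \<in> ball b e}" using \<open>0 < e\<close> by simp
      from wfE_min[OF wf this] obtain b where b: "x \<in> ball b e" "\<And>c. (c, b) \<in> lt \<Longrightarrow> x \<notin> ball c e"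
        by auto
      obtain d where d: "0 < d" "ball x d \<subseteq> ball b e" using b(1) open_ball open_contains_ball by blast
      obtain n where "1 / Suc n < d" using nat_approx_posE[OF d(1)] by blast
      then have "ball x (1 / Suc n) \<subseteq> ball b e" using d subset_ball by (meson less_imp_le order_trans)
      then have "x \<in> E n b" using b by (auto simp: E_def)
      then have "t \<in> N n b" using x t by (auto simp: N_def M_def)
      then have "b \<in> J n" using t by auto
      then show "x \<in> (\<Union>b\<in>(\<Union>n. J n). ball b e)" using b by auto
    qed
    then show ?thesis using J by (intro exI[of _ "\<Union>n. J n"]) auto
  qed
  then have "\<forall>n. \<exists>J. countable J \<and> (AE t in M. F t \<subseteq> (\<Union>b\<in>J. ball b (1 / Suc n)))" by simp
  then obtain J where J: "\<And>n. countable (J n)" "\<And>n. AE t in M. F t \<subseteq> (\<Union>b\<in>J n. ball b (1 / Suc n))"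
    by metis
  have "AE t in M. \<forall>n. F t \<subseteq> (\<Union>b\<in>J n. ball b (1 / Suc n))" using J(2) by (simp add: AE_all_countable)
  then have "AE t in M. F t \<subseteq> closure (\<Union>n. J n)"
  proof (rule AE_mp, intro AE_I2 impI subsetI)
    fix t x assume t: "\<forall>n. F t \<subseteq> (\<Union>b\<in>J n. ball b (1 / Suc n))" and x: "x \<in> F t"
    show "x \<in> closure (\<Union>n. J n)"
      unfolding closure_approachable
    proof (intro allI impI)
      fix e :: real assume "0 < e"
      then obtain n where n: "1 / Suc n < e" using nat_approx_posE by blast
      obtain b where "b \<in> J n" "dist b x < 1 / Suc n" using t x by force
      then show "\<exists>y\<in>\<Union>n. J n. dist y x < e" using n by force
    qed
  qed
  moreover have "countable (\<Union>n. J n)" using J(1) by simp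
  ultimately show ?thesis unfolding M_def by blast
qed

text \<open>Successive refinement in the manner of Kuratowski and Ryll-Nardzewski:
  \<open>H (Suc k) t\<close> is the part of \<open>H k t\<close> in the first closed ball of radius
  1 / (k + 1), along an enumeration of \<open>D\<close>, that meets \<open>H k t\<close>. Closed
  balls preserve both compactness and the measurability of closed hits. The intersection is nonempty
  by compactness and a single point because the radii tend to 0.\<close>

lemma compact_setmap_selection:
  fixes G :: "'t \<Rightarrow> 'u::metric_space set"
  assumes D: "countable D"
    and G: "\<And>t. t \<in> space M \<Longrightarrow> compact (G t)" "\<And>t. t \<in> space M \<Longrightarrow> G t \<noteq> {}"
      "\<And>t. t \<in> space M \<Longrightarrow> G t \<subseteq> closure D"
    and hit: "\<And>C. closed C \<Longrightarrow> {t \<in> space M. G t \<inter> C \<noteq> {}} \<in> sets M"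
  shows "\<exists>u \<in> borel_measurable M. \<forall>t\<in>space M. u t \<in> G t"
proof -
  define d where "d = from_nat_into D"
  have D_sub: "D \<subseteq> range d" using D unfolding d_def by (metis UNIV_I from_nat_into_surj image_eqI subsetI)
  define i where "i P k = (LEAST m. P \<inter> cball (d m) (1 / Suc k) \<noteq> {})" for P k
  define H where "H = rec_nat G (\<lambda>k H' t. H' t \<inter> cball (d (i (H' t) k)) (1 / Suc k))"
  have H_0: "H 0 = G" and H_Suc: "H (Suc k) t = H k t \<inter> cball (d (i (H k t) k)) (1 / Suc k)" for k t
    by (simp_all add: H_def)
  have H_dec: "H n t \<subseteq> H m t" if "m \<le> n" for m n t
    using that by (induction n rule: dec_induct) (auto simp: H_Suc)
  have i: "P \<inter> cball (d (i P k)) (1 / Suc k) \<noteq> {}" if P: "P \<noteq> {}" "P \<subseteq> closure D" for P k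
  proof -
    obtain x where "x \<in> P" "x \<in> closure D" using P by blast
    then obtain y where "y \<in> D" "dist y x < 1 / Suc k"
      unfolding closure_approachable by (meson of_nat_0_less_iff zero_less_Suc zero_less_divide_1_iff)
    moreover obtain m where "y = d m" using D_sub \<open>y \<in> D\<close> by auto
    ultimately have "P \<inter> cball (d m) (1 / Suc k) \<noteq> {}" using \<open>x \<in> P\<close> by (auto simp: disjoint_iff less_imp_le)
    then show ?thesis unfolding i_def by (rule LeastI)
  qed
  have H: "compact (H k t) \<and> H k t \<noteq> {} \<and> H k t \<subseteq> closure D" if "t \<in> space M" for k t
  proof (induction k)
    case (Suc k)
    then show ?case using i[of "H k t" k] by (auto simp: H_Suc intro: compact_Int_closed)
  qed (use G that in \<open>auto simp: H_0\<close>)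
  have H_hit: "{t \<in> space M. H k t \<inter> C \<noteq> {}} \<in> sets M" if "closed C" for k C
    using that
  proof (induction k arbitrary: C)
    case (Suc k)
    let ?h = "\<lambda>C. {t \<in> space M. H k t \<inter> C \<noteq> {}}" and ?B = "\<lambda>m. cball (d m) (1 / Suc k)"
    \<comment> \<open>The times are sorted by the least index \<open>m\<close> whose ball meets
      \<open>H k t\<close>. For a fixed \<open>m\<close> the refined set is cut out by one fixed
      closed ball, and the induction hypothesis applies.\<close>
    have "{t \<in> space M. H (Suc k) t \<inter> C \<noteq> {}} =
        (\<Union>m. (?h (?B m) - (\<Union>m'\<in>{..<m}. ?h (?B m'))) \<inter> ?h (?B m \<inter> C))" (is "?L = ?R")
    proof (intro equalityI subsetI)
      fix t assume t: "t \<in> ?L"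
      define m where "m = i (H k t) k"
      have "t \<in> ?h (?B m)" using i[of "H k t" k] H[of t k] t by (auto simp: m_def)
      moreover have "t \<notin> ?h (?B m')" if "m' < m" for m'
        using not_less_Least[OF that[unfolded m_def i_def]] by simp
      moreover have "t \<in> ?h (?B m \<inter> C)" using t by (auto simp: H_Suc m_def)
      ultimately show "t \<in> ?R" by blast
    next
      fix t assume "t \<in> ?R"
      then obtain m where m: "t \<in> space M" "H k t \<inter> ?B m \<noteq> {}" "\<And>m'. m' < m \<Longrightarrow> H k t \<inter> ?B m' = {}" "H k t \<inter> (?B m \<inter> C) \<noteq> {}"
        by blast
      then have "i (H k t) k = m" unfolding i_def by (intro Least_equality) (auto simp: not_less[symmetric])
      then show "t \<in> ?L" using m by (auto simp: H_Suc)
    qed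
    moreover have "(?h (?B m) - (\<Union>m'\<in>{..<m}. ?h (?B m'))) \<inter> ?h (?B m \<inter> C) \<in> sets M" for m
    proof -
      have "?h (?B m') \<in> sets M" for m' by (rule Suc.IH) simp
      moreover have "?h (?B m \<inter> C) \<in> sets M" by (rule Suc.IH) (use Suc.prems in auto)
      ultimately show ?thesis by (intro sets.Int sets.Diff sets.finite_UN) auto
    qed
    then have "?R \<in> sets M" by (intro sets.countable_UN) blast
    ultimately show ?case by (simp only:)
  qed (auto simp: H_0 hit)
  define u where "u t = (SOME y. y \<in> (\<Inter>k. H k t))" for t
  have u: "u t \<in> H k t" if t: "t \<in> space M" for t k
  proof -
    have "(\<Inter>k. H k t) \<noteq> {}" 
    proof (rule Inter_decreasing_compacts_nonempty)
      show "compact (H k t)" "H k t \<noteq> {}" for k using H[OF t, of k] by blast+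
      show "H n t \<subseteq> H m t" if "m \<le> n" for m n using that by (rule H_dec)
    qed
    then have "u t \<in> (\<Inter>k. H k t)" by (simp only: u_def some_in_eq not_False_eq_True)
    then show ?thesis by blast
  qed
  have uniq: "y = u t" if "t \<in> space M" "\<And>k. y \<in> H k t" for t y
  proof (rule ccontr)
    assume "y \<noteq> u t"
    then obtain k where k: "1 / Suc k < dist y (u t) / 2" using nat_approx_posE[of "dist y (u t) / 2"] by auto
    have "y \<in> cball (d (i (H k t) k)) (1 / Suc k)" "u t \<in> cball (d (i (H k t) k)) (1 / Suc k)"
      using that(2)[of "Suc k"] u[OF that(1), of "Suc k"] by (auto simp: H_Suc)
    then have "dist y (u t) \<le> 1 / Suc k + 1 / Suc k"
      by (intro order_trans[OF dist_triangle3 add_mono]) auto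
    then show False using k by simp
  qed
  have "u \<in> borel_measurable M"
  proof (rule borel_measurableI)
    fix W :: "'u set" assume "open W"
    then have C: "closed (- W)" by (simp add: closed_Compl)
    \<comment> \<open>If every \<open>H k t\<close> meets the closed set - W, then by compactness so
      does their intersection, which consists of \<open>u t\<close> alone.\<close>
    have "{t \<in> space M. u t \<in> - W} = (\<Inter>k. {t \<in> space M. H k t \<inter> - W \<noteq> {}})"
    proof (intro equalityI subsetI)
      fix t assume t: "t \<in> (\<Inter>k. {t \<in> space M. H k t \<inter> - W \<noteq> {}})"
      then have tM: "t \<in> space M" by auto
      have "(\<Inter>k. H k t \<inter> - W) \<noteq> {}"
      proof (rule Inter_decreasing_compacts_nonempty)
        show "compact (H k t \<inter> - W)" for k using H[OF tM] C by (blast intro: compact_Int_closed)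
        show "H k t \<inter> - W \<noteq> {}" for k using t by blast
        show "H n t \<inter> - W \<subseteq> H m t \<inter> - W" if "m \<le> n" for m n using H_dec[OF that] by blast
      qed
      then obtain y where y: "\<And>k. y \<in> H k t" "y \<in> - W" by blast
      have "y = u t" using tM y(1) by (rule uniq)
      then show "t \<in> {t \<in> space M. u t \<in> - W}" using y(2) tM by simp
    next
      fix t assume "t \<in> {t \<in> space M. u t \<in> - W}"
      then have "t \<in> space M" "u t \<in> - W" by auto
      then show "t \<in> (\<Inter>k. {t \<in> space M. H k t \<inter> - W \<noteq> {}})" using u by blast
    qed
    also have "\<dots> \<in> sets M" using H_hit[OF C] by auto
    finally have "space M - {t \<in> space M. u t \<in> - W} \<in> sets M" by (rule sets.compl_sets)
    moreover have "space M - {t \<in> space M. u t \<in> - W} = u -` W \<inter> space M" by auto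
    ultimately show "u -` W \<inter> space M \<in> sets M" by simp
  qed
  moreover have "\<forall>t\<in>space M. u t \<in> G t" using u[of _ 0] by (simp add: H_0)
  ultimately show ?thesis by blast
qed

section \<open>Vector fields and truncated measures\<close>

text \<open>Evaluation at \<open>x\<close> is continuous for uniform convergence on compact sets,
  because the singleton of \<open>x\<close> is compact.\<close>

lemma measurable_eval_C0_borel:
  assumes "w \<in> measurable M (C0_borel :: ('a::topological_space \<Rightarrow> 'b::metric_space) measure)"
  shows "(\<lambda>t. w t x) \<in> borel_measurable M"
proof -
  have sub: "{W. openin C0_topology W} \<subseteq> Pow (C0 :: ('a \<Rightarrow> 'b) set)" by (auto simp: openin_C0_topology)
  have "(\<lambda>f. f x) \<in> borel_measurable (C0_borel :: ('a \<Rightarrow> 'b) measure)"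
  proof (rule borel_measurableI)
    fix S :: "'b set" assume S: "open S"
    have "openin C0_topology {f \<in> C0. f x \<in> S}"
      unfolding openin_C0_topology
    proof (intro conjI ballI)
      fix f assume f: "f \<in> {f \<in> C0. f x \<in> S}"
      then obtain e where "0 < e" "ball (f x) e \<subseteq> S" using S open_contains_ball by blast
      then show "\<exists>K e. compact K \<and> 0 < e \<and> {g \<in> C0. \<forall>x\<in>K. dist (g x) (f x) < e} \<subseteq> {f \<in> C0. f x \<in> S}"
        by (intro exI[of _ "{x}"] exI[of _ e]) (auto simp: subset_iff dist_commute)
    qed auto
    then have "{f \<in> C0. f x \<in> S} \<in> sets C0_borel" unfolding C0_borel_def using sub by auto
    moreover have "(\<lambda>f. f x) -` S \<inter> space C0_borel = {f \<in> C0. f x \<in> S}"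
      using sub by (auto simp: C0_borel_def space_measure_of_conv)
    ultimately show "(\<lambda>f. f x) -` S \<inter> space (C0_borel :: ('a \<Rightarrow> 'b) measure) \<in> sets C0_borel" by simp
  qed
  from measurable_compose[OF assms this] show ?thesis .
qed

text \<open>
  The sets of fields within \<open>1 / Suc n\<close> of \<open>q\<close> on \<open>B\<close>, for \<open>B\<close> in a countable base and \<open>q\<close> in a
  countable dense set, need not be open, but finite intersections of them still generate the topology.
\<close>
lemma measurable_C0_borelI:
  fixes w :: "'t \<Rightarrow> 'a::second_countable_topology \<Rightarrow> 'b::{metric_space, second_countable_topology}"
  assumes C0: "\<And>t. t \<in> space M \<Longrightarrow> w t \<in> C0"
    and meas: "\<And>x. (\<lambda>t. w t x) \<in> borel_measurable M"
  shows "w \<in> measurable M C0_borel"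
proof -
  obtain D :: "'a set" where D: "countable D" "\<And>X. open X \<Longrightarrow> X \<noteq> {} \<Longrightarrow> \<exists>d\<in>D. d \<in> X"
    by (rule countable_dense_setE) blast
  obtain Q :: "'b set" where Q: "countable Q" "\<And>X. open X \<Longrightarrow> X \<noteq> {} \<Longrightarrow> \<exists>d\<in>Q. d \<in> X"
    by (rule countable_dense_setE) blast
  obtain \<B> :: "'a set set" where \<B>: "countable \<B>" "topological_basis \<B>" using ex_countable_basis by blast
  define P where "P = \<B> \<times> Q \<times> (UNIV :: nat set)"
  define S where "S s = {f :: 'a \<Rightarrow> 'b. \<forall>x\<in>fst s. dist (f x) (fst (snd s)) \<le> 1 / Suc (snd (snd s))}"
    for s :: "'a set \<times> 'b \<times> nat"
  have "countable P" using \<B> Q by (simp add: P_def)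
  have S_meas: "{t \<in> space M. w t \<in> S s} \<in> sets M" if "s \<in> P" for s
  proof -
    obtain B q n where s: "s = (B, q, n)" by (cases s)
    have "open B" using that \<B>(2) by (auto simp: P_def s topological_basis_open)
    \<comment> \<open>By continuity of \<open>w t\<close>, a violation of the bound somewhere in the
      open set \<open>B\<close> persists on a nonempty open subset and hence occurs at a point of
      \<open>D\<close>.\<close>
    have "w t \<in> S s \<longleftrightarrow> (\<forall>x\<in>D \<inter> B. dist (w t x) q \<le> 1 / Suc n)" if t: "t \<in> space M" for t
    proof
      assume R: "\<forall>x\<in>D \<inter> B. dist (w t x) q \<le> 1 / Suc n"
      show "w t \<in> S s"
      proof (rule ccontr)
        assume "w t \<notin> S s"
        then obtain x where "x \<in> {x. 1 / Suc n < dist (w t x) q} \<inter> B" by (auto simp: S_def s not_le)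
        moreover have "open ({x. 1 / Suc n < dist (w t x) q} \<inter> B)"
          using C0[OF t] \<open>open B\<close> by (intro open_Int open_Collect_less continuous_intros) (auto simp: C0_def)
        ultimately obtain x where "x \<in> D" "x \<in> {x. 1 / Suc n < dist (w t x) q} \<inter> B" using D(2) by blast
        then show False using R by (auto simp: not_le[symmetric])
      qed
    qed (auto simp: S_def s)
    then have "{t \<in> space M. w t \<in> S s} = {t \<in> space M. \<forall>x\<in>D \<inter> B. dist (w t x) q \<le> 1 / Suc n}" by blast
    also have "\<dots> \<in> sets M"
    proof (rule sets.sets_Collect_countable_All')
      show "countable (D \<inter> B)" using D(1) by blast
      show "{t \<in> space M. dist (w t x) q \<le> 1 / Suc n} \<in> sets M" for x
        using meas by (intro borel_measurable_le borel_measurable_dist) auto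
    qed
    finally show ?thesis .
  qed
  have base: "\<exists>I. finite I \<and> I \<subseteq> P \<and> f \<in> (\<Inter>s\<in>I. S s) \<and> C0 \<inter> (\<Inter>s\<in>I. S s) \<subseteq> W"
    if W: "openin C0_topology W" and f: "f \<in> W" for W f
  proof -
    obtain K e where K: "compact K" "0 < e" "{g \<in> C0. \<forall>x\<in>K. dist (g x) (f x) < e} \<subseteq> W"
      using W f unfolding openin_C0_topology by blast
    have "f \<in> C0" using W f by (auto simp: openin_C0_topology)
    obtain n where n: "1 / Suc n < e / 2" using nat_approx_posE[of "e / 2"] \<open>0 < e\<close> by auto
    \<comment> \<open>All these sets share the accuracy \<open>n\<close>. On the base set of one of
      them, any two of its members differ by at most 2 / (n + 1), which is below
      \<open>e\<close>.\<close>
    define A where "A = {s \<in> P. f \<in> S s \<and> snd (snd s) = n}"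
    have cover: "K \<subseteq> (\<Union>s\<in>A. fst s)"
    proof
      fix x
      have "ball (f x) (1 / Suc n) \<noteq> {}" by simp
      then obtain q where q: "q \<in> Q" "dist (f x) q < 1 / Suc n" using Q(2)[OF open_ball] by (metis mem_ball)
      have "open {y. dist (f y) q < 1 / Suc n}"
        using \<open>f \<in> C0\<close> by (intro open_Collect_less continuous_intros) (auto simp: C0_def)
      then obtain B where B: "B \<in> \<B>" "x \<in> B" "B \<subseteq> {y. dist (f y) q < 1 / Suc n}"
        using topological_basisE[OF \<B>(2)] q by (metis mem_Collect_eq)
      then have "(B, q, n) \<in> A" using q by (auto simp: A_def P_def S_def intro: less_imp_le)
      then show "x \<in> (\<Union>s\<in>A. fst s)" using B(2) by force
    qed
    have "open (fst s)" if "s \<in> A" for s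
      using that \<B>(2) by (auto simp: A_def P_def topological_basis_open)
    from compactE_image[OF K(1) this cover]
    obtain I where I: "I \<subseteq> A" "finite I" "K \<subseteq> (\<Union>s\<in>I. fst s)" .
    have "g \<in> W" if g: "g \<in> C0" "g \<in> (\<Inter>s\<in>I. S s)" for g
    proof -
      have "dist (g x) (f x) < e" if x: "x \<in> K" for x
      proof -
        obtain s where s: "s \<in> I" "x \<in> fst s" using I(3) x by blast
        then have "dist (g x) (fst (snd s)) \<le> 1 / Suc n" "dist (f x) (fst (snd s)) \<le> 1 / Suc n"
          using I(1) g(2) by (auto simp: A_def S_def)
        then have "dist (g x) (f x) \<le> 1 / Suc n + 1 / Suc n" by (rule order_trans[OF dist_triangle2 add_mono])
        then show ?thesis using n by simp
      qed
      then show ?thesis using K(3) g(1) by auto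
    qed
    then show ?thesis using I by (intro exI[of _ I]) (auto simp: A_def)
  qed
  show ?thesis
    unfolding C0_borel_def
  proof (rule measurable_measure_of)
    fix W assume "W \<in> {W. openin (C0_topology :: ('a \<Rightarrow> 'b) topology) W}"
    then have W: "openin C0_topology W" by simp
    define \<I> where "\<I> = {I. finite I \<and> I \<subseteq> P \<and> C0 \<inter> (\<Inter>s\<in>I. S s) \<subseteq> W}"
    have "countable \<I>"
      by (rule countable_subset[OF _ countable_Collect_finite_subset[OF \<open>countable P\<close>]]) (auto simp: \<I>_def)
    have "w -` W \<inter> space M = (\<Union>I\<in>\<I>. {t \<in> space M. \<forall>s\<in>I. w t \<in> S s})"
    proof (intro equalityI subsetI)
      fix t assume t: "t \<in> w -` W \<inter> space M"
      then obtain I where "I \<in> \<I>" "w t \<in> (\<Inter>s\<in>I. S s)" using base[OF W, of "w t"] by (auto simp: \<I>_def)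
      then show "t \<in> (\<Union>I\<in>\<I>. {t \<in> space M. \<forall>s\<in>I. w t \<in> S s})" using t by auto
    qed (use C0 in \<open>auto simp: \<I>_def\<close>)
    also have "\<dots> \<in> sets M"
    proof (rule sets.countable_UN''[OF \<open>countable \<I>\<close>])
      fix I assume "I \<in> \<I>"
      then show "{t \<in> space M. \<forall>s\<in>I. w t \<in> S s} \<in> sets M"
        using S_meas by (intro sets.sets_Collect_countable_All') (auto simp: \<I>_def countable_finite)
    qed
    finally show "w -` W \<inter> space M \<in> sets M" .
  qed (use C0 in \<open>auto simp: openin_C0_topology\<close>)
qed

section \<open>Supports, transport plans and projection of measures to balls\<close>

lemma AE_in_msupp:
  fixes \<mu> :: "'a::second_countable_topology measure"
  assumes "\<mu> \<in> borel_probs"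
  shows "AE x in \<mu>. x \<in> msupp \<mu>"
proof -
  obtain \<B> :: "'a set set" where \<B>: "countable \<B>" "topological_basis \<B>" using ex_countable_basis by blast
  have sets: "sets \<mu> = sets borel" using assms by (simp add: borel_probs_def)
  \<comment> \<open>A point outside the support has a basic neighbourhood of measure zero, and there
    are only countably many basic sets to remove.\<close>
  define N where "N = (\<Union>B\<in>{B\<in>\<B>. emeasure \<mu> B = 0}. B)"
  have "B \<in> sets \<mu>" if "B \<in> \<B>" for B using that \<B>(2) sets by (simp add: topological_basis_open)
  then have "N \<in> null_sets \<mu>"
    unfolding N_def using \<B>(1) by (intro null_sets_UN') (auto intro: countable_subset[of _ \<B>])
  then have "AE x in \<mu>. x \<notin> N" by (rule AE_not_in)
  then show ?thesis
  proof (rule AE_mp, intro AE_I2 impI)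
    fix x assume x: "x \<notin> N"
    show "x \<in> msupp \<mu>"
      unfolding msupp_def
    proof (intro CollectI allI impI, elim conjE)
      fix W :: "'a set" assume "open W" "x \<in> W"
      then obtain B where B: "B \<in> \<B>" "x \<in> B" "B \<subseteq> W" using topological_basisE[OF \<B>(2)] by metis
      then have "emeasure \<mu> B \<noteq> 0" using x by (auto simp: N_def)
      then have "0 < emeasure \<mu> B" by (simp add: zero_less_iff_neq_zero)
      also have "\<dots> \<le> emeasure \<mu> W" using B \<open>open W\<close> sets by (intro emeasure_mono) auto
      finally show "0 < emeasure \<mu> W" .
    qed
  qed
qed

lemma closed_msupp: "closed (msupp \<mu>)"
  unfolding closed_def
proof (subst open_subopen, intro ballI)
  fix x assume "x \<in> - msupp \<mu>"
  then obtain W where W: "open W" "x \<in> W" "\<not> 0 < emeasure \<mu> W" by (auto simp: msupp_def)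
  then have "W \<subseteq> - msupp \<mu>" by (auto simp: msupp_def)
  then show "\<exists>W. open W \<and> x \<in> W \<and> W \<subseteq> - msupp \<mu>" using W by blast
qed

lemma probs_on_subset_probs_c:
  fixes K :: "'a::t2_space set"
  assumes "compact K"
  shows "probs_on K \<subseteq> probs_c"
  using assms closed_msupp closed_Int_compact[of _ K] unfolding probs_on_def probs_c_def
  by (metis (no_types, lifting) Int_absorb2 mem_Collect_eq subsetI)

lemma borel_measurable_fst_snd:
  fixes \<gamma> :: "('a::euclidean_space \<times> 'a) measure"
  assumes "sets \<gamma> = sets borel"
  shows "fst \<in> borel_measurable \<gamma>" "snd \<in> borel_measurable \<gamma>"
  unfolding measurable_cong_sets[OF assms refl]
  by (intro borel_measurable_continuous_onI continuous_intros)+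

text \<open>Needed to compare values of \<open>W1\<close>: \<open>enn2real\<close> sends infinity to
  0, so it is monotone only where the larger value is finite. The product measure is a plan of
  finite cost, since both supports are bounded.\<close>

lemma ex_finite_transport_plan:
  fixes \<mu> \<nu> :: "'a::euclidean_space measure"
  assumes "\<mu> \<in> probs_c" "\<nu> \<in> probs_c"
  shows "\<exists>\<gamma>\<in>transport_plans \<mu> \<nu>. (\<integral>\<^sup>+p. ennreal (dist (fst p) (snd p)) \<partial>\<gamma>) < \<infinity>"
proof -
  have sets: "sets \<mu> = sets borel" "sets \<nu> = sets borel" "prob_space \<mu>" "prob_space \<nu>"
    using assms by (auto simp: probs_c_def borel_probs_def)
  interpret \<mu>: prob_space \<mu> by fact
  interpret \<nu>: prob_space \<nu> by fact
  define \<gamma> where "\<gamma> = \<mu> \<Otimes>\<^sub>M \<nu>"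
  have "sets \<gamma> = sets (borel \<Otimes>\<^sub>M borel)" unfolding \<gamma>_def using sets by (intro sets_pair_measure_cong)
  then have \<gamma>_sets: "sets \<gamma> = sets borel" by (simp only: borel_prod)
  have fst: "distr \<gamma> borel fst = \<mu>"
  proof -
    have "distr \<gamma> borel fst = distr \<gamma> \<mu> fst" using sets by (intro distr_cong) auto
    also have "\<dots> = \<mu>" unfolding \<gamma>_def by (rule \<nu>.distr_pair_fst)
    finally show ?thesis .
  qed
  have snd: "distr \<gamma> borel snd = \<nu>"
  proof (rule measure_eqI)
    fix A assume "A \<in> sets (distr \<gamma> borel snd)"
    then have A: "A \<in> sets \<nu>" using sets by simp
    have "emeasure (distr \<gamma> borel snd) A = emeasure \<gamma> (snd -` A \<inter> space \<gamma>)"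
      using A sets by (intro emeasure_distr borel_measurable_fst_snd \<gamma>_sets) auto
    also have "snd -` A \<inter> space \<gamma> = space \<mu> \<times> A"
      using sets.sets_into_space[OF A] by (auto simp: \<gamma>_def space_pair_measure)
    also have "emeasure \<gamma> \<dots> = emeasure \<nu> A"
      unfolding \<gamma>_def using A by (simp add: \<nu>.emeasure_pair_measure_Times \<mu>.emeasure_space_1)
    finally show "emeasure (distr \<gamma> borel snd) A = emeasure \<nu> A" .
  qed (simp add: sets)
  have fin: "(\<integral>\<^sup>+x. ennreal (norm x) \<partial>\<rho>) < \<infinity>" if "\<rho> \<in> probs_c" for \<rho> :: "'a measure"
  proof -
    have \<rho>: "\<rho> \<in> borel_probs" "compact (msupp \<rho>)" "prob_space \<rho>"
      using that by (auto simp: probs_c_def borel_probs_def)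
    obtain R where R: "\<And>x. x \<in> msupp \<rho> \<Longrightarrow> norm x \<le> R"
      using compact_imp_bounded[OF \<rho>(2)] bounded_iff by blast
    have "(\<integral>\<^sup>+x. ennreal (norm x) \<partial>\<rho>) \<le> (\<integral>\<^sup>+x. ennreal R \<partial>\<rho>)"
      using AE_in_msupp[OF \<rho>(1)] by (intro nn_integral_mono_AE) (auto intro!: ennreal_leI R)
    also have "\<dots> = ennreal R" using prob_space.emeasure_space_1[OF \<rho>(3)] by simp
    also have "\<dots> < \<infinity>" by simp
    finally show ?thesis .
  qed
  have meas: "fst \<in> borel_measurable \<gamma>" "snd \<in> borel_measurable \<gamma>"
    by (rule borel_measurable_fst_snd[OF \<gamma>_sets])+
  have "(\<integral>\<^sup>+p. ennreal (dist (fst p) (snd p)) \<partial>\<gamma>) \<le> (\<integral>\<^sup>+p. ennreal (norm (fst p)) + ennreal (norm (snd p)) \<partial>\<gamma>)"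
    by (intro nn_integral_mono) (simp add: dist_norm norm_triangle_ineq4 ennreal_plus[symmetric] del: ennreal_plus)
  also have "\<dots> = (\<integral>\<^sup>+p. ennreal (norm (fst p)) \<partial>\<gamma>) + (\<integral>\<^sup>+p. ennreal (norm (snd p)) \<partial>\<gamma>)"
    using measurable_compose[OF meas(1), of "\<lambda>x. ennreal (norm x)" borel]
      measurable_compose[OF meas(2), of "\<lambda>x. ennreal (norm x)" borel]
    by (intro nn_integral_add) auto
  also have "(\<integral>\<^sup>+p. ennreal (norm (fst p)) \<partial>\<gamma>) = (\<integral>\<^sup>+x. ennreal (norm x) \<partial>\<mu>)"
    using meas by (subst fst[symmetric], subst nn_integral_distr) auto
  also have "(\<integral>\<^sup>+p. ennreal (norm (snd p)) \<partial>\<gamma>) = (\<integral>\<^sup>+x. ennreal (norm x) \<partial>\<nu>)"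
    using meas by (subst snd[symmetric], subst nn_integral_distr) auto
  finally have "(\<integral>\<^sup>+p. ennreal (dist (fst p) (snd p)) \<partial>\<gamma>) < \<infinity>"
    using fin[OF assms(1)] fin[OF assms(2)] by (auto simp: less_top[symmetric] top_unique)
  then show ?thesis using \<gamma>_sets fst snd by (auto simp: transport_plans_def)
qed

text \<open>Applying \<open>f\<close> to both coordinates of a plan gives a plan between the image
  measures, whose cost is no larger because \<open>f\<close> is nonexpansive.\<close>

lemma W1_distr_le:
  fixes f :: "'a::euclidean_space \<Rightarrow> 'a"
  assumes \<mu>\<nu>: "\<mu> \<in> probs_c" "\<nu> \<in> probs_c" and f: "\<And>x y. dist (f x) (f y) \<le> dist x y"
    and meas: "f \<in> borel_measurable borel"
  shows "W1 (distr \<mu> borel f) (distr \<nu> borel f) \<le> W1 \<mu> \<nu>"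
proof -
  let ?c = "\<lambda>\<gamma> :: ('a \<times> 'a) measure. \<integral>\<^sup>+p. ennreal (dist (fst p) (snd p)) \<partial>\<gamma>"
  have "(INF \<gamma>\<in>transport_plans (distr \<mu> borel f) (distr \<nu> borel f). ?c \<gamma>) \<le> (INF \<gamma>\<in>transport_plans \<mu> \<nu>. ?c \<gamma>)"
  proof (rule INF_mono)
    fix \<gamma> assume "\<gamma> \<in> transport_plans \<mu> \<nu>"
    then have \<gamma>: "sets \<gamma> = sets borel" "distr \<gamma> borel fst = \<mu>" "distr \<gamma> borel snd = \<nu>"
      by (auto simp: transport_plans_def)
    define g where "g p = (f (fst p), f (snd p))" for p :: "'a \<times> 'a"
    note m = borel_measurable_fst_snd[OF \<gamma>(1)]
    have g: "g \<in> borel_measurable \<gamma>"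
      unfolding g_def by (intro borel_measurable_Pair measurable_compose[OF m(1) meas] measurable_compose[OF m(2) meas])
    have "distr (distr \<gamma> borel g) borel fst = distr \<mu> borel f" "distr (distr \<gamma> borel g) borel snd = distr \<nu> borel f"
      unfolding \<gamma>(2,3)[symmetric] using g m meas borel_measurable_fst_snd[of "borel :: ('a \<times> 'a) measure"] by (simp_all add: distr_distr o_def g_def)
    then have "distr \<gamma> borel g \<in> transport_plans (distr \<mu> borel f) (distr \<nu> borel f)"
      by (simp add: transport_plans_def)
    moreover have "?c (distr \<gamma> borel g) \<le> ?c \<gamma>"
      using g f borel_measurable_fst_snd[of "borel :: ('a \<times> 'a) measure"]
      by (subst nn_integral_distr) (auto intro!: nn_integral_mono ennreal_leI simp: g_def)
    ultimately show "\<exists>\<gamma>'\<in>transport_plans (distr \<mu> borel f) (distr \<nu> borel f). ?c \<gamma>' \<le> ?c \<gamma>" by blast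
  qed
  moreover have "(INF \<gamma>\<in>transport_plans \<mu> \<nu>. ?c \<gamma>) < top"
    using ex_finite_transport_plan[OF \<mu>\<nu>] by (auto simp: INF_less_iff)
  ultimately show ?thesis unfolding W1_def by (rule enn2real_mono)
qed

definition proj_ball :: "real \<Rightarrow> 'a::euclidean_space \<Rightarrow> 'a" where
  "proj_ball R = closest_point (cball 0 R)"

lemma proj_ball:
  fixes x y :: "'a::euclidean_space"
  assumes "0 \<le> R"
  shows "proj_ball R x \<in> cball 0 R" "dist (proj_ball R x) (proj_ball R y) \<le> dist x y"
    "(proj_ball R :: 'a \<Rightarrow> 'a) \<in> borel_measurable borel" "x \<in> cball 0 R \<Longrightarrow> proj_ball R x = x"
proof -
  have ne: "cball (0::'a) R \<noteq> {}" using assms by simp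
  show "proj_ball R x \<in> cball 0 R" unfolding proj_ball_def by (rule closest_point_in_set[OF closed_cball ne])
  show "dist (proj_ball R x) (proj_ball R y) \<le> dist x y"
    unfolding proj_ball_def by (rule closest_point_lipschitz[OF convex_cball closed_cball ne])
  show "(proj_ball R :: 'a \<Rightarrow> 'a) \<in> borel_measurable borel"
    unfolding proj_ball_def
    by (intro borel_measurable_continuous_onI continuous_on_closest_point convex_cball closed_cball ne)
  show "x \<in> cball 0 R \<Longrightarrow> proj_ball R x = x" unfolding proj_ball_def by (rule closest_point_self)
qed

text \<open>Mass outside the ball is moved to the boundary sphere, not discarded. The result is
  again a probability measure, and since the projection to a convex set is nonexpansive,
  \<open>W1\<close> does not grow.\<close>

definition truncate :: "real \<Rightarrow> 'a::euclidean_space measure \<Rightarrow> 'a measure" where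
  "truncate R \<mu> = distr \<mu> borel (proj_ball R)"

lemma truncate_in_probs_on:
  fixes \<mu> :: "'a::euclidean_space measure"
  assumes "0 \<le> R" "\<mu> \<in> borel_probs"
  shows "truncate R \<mu> \<in> probs_on (cball 0 R)"
proof -
  have \<mu>: "sets \<mu> = sets borel" "prob_space \<mu>" using assms(2) by (auto simp: borel_probs_def)
  have meas: "proj_ball R \<in> borel_measurable \<mu>"
    unfolding measurable_cong_sets[OF \<mu>(1) refl] by (rule proj_ball(3)[OF assms(1)])
  have "x \<in> cball 0 R" if "x \<in> msupp (truncate R \<mu>)" for x
  proof (rule ccontr)
    assume "x \<notin> cball 0 R"
    then have "0 < emeasure (truncate R \<mu>) (- cball 0 R)"
      using that unfolding msupp_def by (auto simp: open_Compl)
    moreover have "proj_ball R -` (- cball (0::'a) R) = {}" using proj_ball(1)[OF assms(1)] by blast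
    then have "emeasure (truncate R \<mu>) (- cball 0 R) = 0"
      unfolding truncate_def by (subst emeasure_distr[OF meas]) (simp_all del: vimage_Compl)
    ultimately show False by simp
  qed
  moreover have "prob_space (truncate R \<mu>)"
    unfolding truncate_def by (rule prob_space.prob_space_distr[OF \<mu>(2) meas])
  ultimately show ?thesis by (auto simp: probs_on_def borel_probs_def truncate_def)
qed

lemma truncate_eq:
  fixes \<mu> :: "'a::euclidean_space measure"
  assumes "0 \<le> R" "\<mu> \<in> probs_on (cball 0 R)"
  shows "truncate R \<mu> = \<mu>"
proof -
  have \<mu>: "sets \<mu> = sets borel" "\<mu> \<in> borel_probs" "msupp \<mu> \<subseteq> cball 0 R"
    using assms(2) by (auto simp: probs_on_def borel_probs_def)
  have meas: "proj_ball R \<in> borel_measurable \<mu>" "(\<lambda>x. x) \<in> borel_measurable \<mu>"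
    unfolding measurable_cong_sets[OF \<mu>(1) refl] by (auto intro: proj_ball(3)[OF assms(1)])
  have "AE x in \<mu>. proj_ball R x = x"
    using AE_in_msupp[OF \<mu>(2)] by eventually_elim (use \<mu>(3) proj_ball(4)[OF assms(1)] in blast)
  then have "truncate R \<mu> = distr \<mu> borel (\<lambda>x. x)"
    unfolding truncate_def using meas by (intro distr_cong_AE) auto
  also have "\<dots> = \<mu>" using \<mu>(1) by (intro distr_id2) simp
  finally show ?thesis .
qed

lemma W1_truncate_le:
  fixes \<mu> \<nu> :: "'a::euclidean_space measure"
  assumes "0 \<le> R" "\<mu> \<in> probs_c" "\<nu> \<in> probs_c"
  shows "W1 (truncate R \<mu>) (truncate R \<nu>) \<le> W1 \<mu> \<nu>"
  unfolding truncate_def using proj_ball[OF assms(1)] by (intro W1_distr_le assms) auto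

section \<open>Measurability along a curve\<close>

text \<open>The distance is controlled only from an earlier to a later time and \<open>d\<close>
  need not be symmetric, so the approach is from the right. The bound is an increment of the
  indefinite integral of \<open>m\<close>, which is continuous.\<close>

lemma AC_curve_right_continuous:
  assumes c: "c \<in> AC_curves T X d" and t: "0 \<le> t"
    and s: "\<And>n. t \<le> s n" "\<And>n. s n \<le> T" "s \<longlonglongrightarrow> t" and "0 < \<delta>"
  shows "eventually (\<lambda>n. d (c t) (c (s n)) < \<delta>) sequentially"
proof -
  obtain m where m: "integrable (lebesgue_on {0..T}) m"
    and le: "\<And>s t. 0 \<le> s \<Longrightarrow> s \<le> t \<Longrightarrow> t \<le> T \<Longrightarrow> d (c s) (c t) \<le> (\<integral>r. m r \<partial>lebesgue_on {s..t})"
    using c by (auto simp: AC_curves_def L1_nonneg_def)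
  have hk: "m integrable_on {0..T}" using m by (intro integrable_on_lebesgue_on) auto
  define I where "I r = integral {0..r} m" for r
  have cont: "continuous_on {0..T} I" unfolding I_def using hk by (rule indefinite_integral_continuous_1)
  have "t \<in> {0..T}" using t order_trans[OF s(1,2)] by auto
  have "(\<lambda>n. I (s n)) \<longlonglongrightarrow> I t"
    by (rule continuous_on_tendsto_compose[OF cont s(3) \<open>t \<in> {0..T}\<close>])
      (use t s(2) order_trans[OF t s(1)] in auto)
  then have "(\<lambda>n. I (s n) - I t) \<longlonglongrightarrow> I t - I t" by (intro tendsto_intros)
  then have "eventually (\<lambda>n. I (s n) - I t < \<delta>) sequentially" using \<open>0 < \<delta>\<close> by (intro order_tendstoD) auto
  moreover have "d (c t) (c (s n)) \<le> I (s n) - I t" for n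
  proof -
    have "integrable (lebesgue_on {t..s n}) m"
      using m by (rule integrable_subinterval) (use t s in auto)
    then have "(\<integral>r. m r \<partial>lebesgue_on {t..s n}) = integral {t..s n} m"
      by (intro lebesgue_integral_eq_integral) auto
    also have "\<dots> = I (s n) - I t"
    proof -
      have "m integrable_on {0..s n}"
        using hk by (rule integrable_on_subinterval) (use t s in auto)
      from Henstock_Kurzweil_Integration.integral_combine[OF t s(1) this] show ?thesis by (simp add: I_def)
    qed
    finally show ?thesis using le[OF t s(1)[of n] s(2)[of n]] by simp
  qed
  ultimately show ?thesis by (auto elim!: eventually_mono intro: le_less_trans)
qed

text \<open>Rounding goes upwards because the curve is approached from the right; the cap keeps the
  sample times in the interval.\<close>

definition grid :: "real \<Rightarrow> nat \<Rightarrow> real \<Rightarrow> real" where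
  "grid T n t = min T (\<lceil>t * real (Suc n)\<rceil> / Suc n)"

lemma grid:
  assumes "t \<in> {0..T}"
  shows "t \<le> grid T n t" "grid T n t \<le> T" "grid T n t \<in> {0..T}" "(\<lambda>n. grid T n t) \<longlonglongrightarrow> t"
proof -
  have lower: "t \<le> grid T n t" for n
    using assms by (simp add: grid_def le_divide_eq)
  then show "t \<le> grid T n t" .
  show "grid T n t \<le> T" by (simp add: grid_def)
  then show "grid T n t \<in> {0..T}" using lower[of n] assms by auto
  have upper: "grid T n t \<le> t + 1 / Suc n" for n
  proof -
    have "\<lceil>t * real (Suc n)\<rceil> \<le> t * real (Suc n) + 1" by linarith
    then have "\<lceil>t * real (Suc n)\<rceil> / Suc n \<le> (t * real (Suc n) + 1) / Suc n" by (rule divide_right_mono) simp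
    also have "\<dots> = t + 1 / Suc n" by (simp add: add_divide_distrib)
    finally have "\<lceil>t * real (Suc n)\<rceil> / Suc n \<le> t + 1 / Suc n" .
    then show ?thesis by (simp add: grid_def min_le_iff_disj)
  qed
  have "(\<lambda>n. 1 / real (Suc n)) \<longlonglongrightarrow> 0"
    using LIMSEQ_inverse_real_of_nat by (simp only: inverse_eq_divide)
  from tendsto_add[OF tendsto_const this, of t] have up: "(\<lambda>n. t + 1 / real (Suc n)) \<longlonglongrightarrow> t" by simp
  show "(\<lambda>n. grid T n t) \<longlonglongrightarrow> t"
    by (rule tendsto_sandwich[OF always_eventually[OF allI[OF lower]] always_eventually[OF allI[OF upper]] tendsto_const up])
qed

lemma measurable_grid:
  assumes "0 \<le> T" and f: "\<And>s. s \<in> {0..T} \<Longrightarrow> f s \<in> measurable (lebesgue_on {0..T}) N"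
  shows "(\<lambda>t. f (grid T n t) t) \<in> measurable (lebesgue_on {0..T}) N"
proof -
  \<comment> \<open>The index ranges over all integers, so the corresponding time is clamped to
    {0..T}, where \<open>f\<close> is known to be measurable. For the indices that occur the lower
    clamp changes nothing.\<close>
  define f' where "f' i = f (min T (max 0 (real_of_int i / Suc n)))" for i
  have "(\<lambda>t. t * real (Suc n)) \<in> borel_measurable (lebesgue_on {0..T})"
    by (intro measurable_restrict_space1 measurable_completion) simp
  then have ceil: "(\<lambda>t. \<lceil>t * real (Suc n)\<rceil>) \<in> measurable (lebesgue_on {0..T}) (count_space UNIV)" by measurable
  have "(\<lambda>t. f' i t) \<in> measurable (lebesgue_on {0..T}) N" for i
    unfolding f'_def using \<open>0 \<le> T\<close> by (intro f) auto
  from measurable_compose_countable[OF this ceil] have *: "(\<lambda>t. f' \<lceil>t * real (Suc n)\<rceil> t) \<in> measurable (lebesgue_on {0..T}) N" .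
  have eq: "f' \<lceil>t * real (Suc n)\<rceil> t = f (grid T n t) t" if "t \<in> space (lebesgue_on {0..T})" for t
  proof -
    have "0 \<le> \<lceil>t * real (Suc n)\<rceil> / Suc n" using that by (intro divide_nonneg_nonneg) (auto simp: zero_le_ceiling intro: less_le_trans[of _ 0])
    then show ?thesis by (simp add: f'_def grid_def max_absorb2)
  qed
  show ?thesis by (rule measurable_cong[THEN iffD1, OF eq *])
qed

lemma pred_lebesgue_on_iff:
  assumes "S \<in> sets lebesgue"
  shows "Measurable.pred (lebesgue_on S) P \<longleftrightarrow> {t \<in> S. P t} \<in> sets lebesgue"
  using assms by (auto simp: pred_def sets_restrict_space_iff)

text \<open>The open set \<open>W\<close> is exhausted by open sets \<open>G k\<close> inside closed
  sets \<open>C k\<close>. Lower semicontinuity carries a hit of \<open>G k\<close> from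
  \<open>c t\<close> to all late grid samples. Upper semicontinuity, applied to the complement of
  \<open>C k\<close>, carries hits at late samples back to a hit of \<open>C k\<close> at
  \<open>c t\<close>. So hitting \<open>W\<close> at \<open>c t\<close> means that, for some
  \<open>k\<close>, all late samples hit \<open>G k\<close>.\<close>

lemma setmap_measurable_along_curve:
  fixes F :: "real \<Rightarrow> 'x \<Rightarrow> 'u::metric_space set"
  assumes "0 \<le> T" and c: "c \<in> AC_curves T X d"
    and meas: "\<And>x. x \<in> X \<Longrightarrow> setmap_measurable T (\<lambda>t. F t x)"
    and cont: "\<And>t. t \<in> {0..T} \<Longrightarrow> setmap_continuous X d (F t)"
  shows "setmap_measurable T (\<lambda>t. F t (c t))"
  unfolding setmap_measurable_def
proof (intro allI impI)
  fix W :: "'u set" assume "open W"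
  define C where "C k = {x. \<forall>y\<in>- W. 1 / Suc k \<le> dist x y}" for k
  define G where "G k = interior (C k)" for k
  have "C k = (\<Inter>y\<in>- W. {x. 1 / Suc k \<le> dist x y})" for k by (auto simp: C_def)
  then have C: "closed (C k)" for k by (auto intro!: closed_INT closed_Collect_le continuous_intros)
  have G: "open (G k)" "G k \<subseteq> C k" for k by (auto simp: G_def interior_subset)
  have C_sub: "C k \<subseteq> W" for k
  proof
    fix x assume x: "x \<in> C k"
    show "x \<in> W"
    proof (rule ccontr)
      assume "x \<notin> W"
      then have "1 / Suc k \<le> dist x x" using x unfolding C_def by blast
      then show False by simp
    qed
  qed
  have W_sub: "\<exists>k. x \<in> G k" if x: "x \<in> W" for x
  proof -
    obtain e where e: "0 < e" "ball x e \<subseteq> W" using \<open>open W\<close> x open_contains_ball by blast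
    obtain k where k: "1 / Suc k < e / 2" using nat_approx_posE[of "e / 2"] e(1) by auto
    have "ball x (e / 2) \<subseteq> C k"
    proof
      fix z assume z: "z \<in> ball x (e / 2)"
      have "1 / Suc k \<le> dist z y" if "y \<in> - W" for y
      proof -
        have "e \<le> dist x y" using e(2) that by (meson ComplD mem_ball not_le subsetD)
        also have "\<dots> \<le> dist x z + dist z y" by (rule dist_triangle)
        finally show ?thesis using z k by simp
      qed
      then show "z \<in> C k" by (simp add: C_def)
    qed
    then have "x \<in> G k" unfolding G_def using e(1) by (intro interiorI[of "ball x (e / 2)"]) auto
    then show ?thesis ..
  qed
  define H where "H k n = {t \<in> {0..T}. F t (c (grid T n t)) \<inter> G k \<noteq> {}}" for k n
  have cX: "c s \<in> X" if "s \<in> {0..T}" for s using c that by (auto simp: AC_curves_def)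
  have near: "eventually (\<lambda>n. d (c t) (c (grid T n t)) < \<delta>) sequentially" if "t \<in> {0..T}" "0 < \<delta>" for t \<delta>
    using c grid[OF that(1)] that by (intro AC_curve_right_continuous) auto
  have Icc: "{0..T} \<in> sets lebesgue" by simp
  have H: "H k n \<in> sets lebesgue" for k n
  proof -
    have "(\<lambda>t. F t (c (grid T n t)) \<inter> G k \<noteq> {}) \<in> measurable (lebesgue_on {0..T}) (count_space UNIV)"
    proof (rule measurable_grid[OF \<open>0 \<le> T\<close>, where f = "\<lambda>s t. F t (c s) \<inter> G k \<noteq> {}"])
      fix s assume "s \<in> {0..T}"
      then have "{t \<in> {0..T}. F t (c s) \<inter> G k \<noteq> {}} \<in> sets lebesgue"
        using meas[OF cX] G by (auto simp: setmap_measurable_def)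
      then show "(\<lambda>t. F t (c s) \<inter> G k \<noteq> {}) \<in> measurable (lebesgue_on {0..T}) (count_space UNIV)"
        by (simp only: pred_lebesgue_on_iff[OF Icc])
    qed
    then show ?thesis unfolding H_def by (simp only: pred_lebesgue_on_iff[OF Icc])
  qed
  have "{t \<in> {0..T}. F t (c t) \<inter> W \<noteq> {}} = (\<Union>k N. \<Inter>n\<in>{N..}. H k n)"
  proof (intro equalityI subsetI)
    fix t assume "t \<in> {t \<in> {0..T}. F t (c t) \<inter> W \<noteq> {}}"
    then obtain x where x: "t \<in> {0..T}" "x \<in> F t (c t)" "x \<in> W" by auto
    obtain k where k: "x \<in> G k" using W_sub[OF x(3)] ..
    then have Gk: "open (G k) \<and> F t (c t) \<inter> G k \<noteq> {}" using G x by blast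
    have "setmap_lsc X d (F t)" using cont[OF x(1)] by (simp add: setmap_continuous_def)
    from this[unfolded setmap_lsc_def, rule_format, OF cX[OF x(1)] Gk]
    obtain \<delta> where \<delta>: "0 < \<delta>" "\<And>y. y \<in> X \<Longrightarrow> d (c t) y < \<delta> \<Longrightarrow> F t y \<inter> G k \<noteq> {}" by blast
    obtain N where "\<And>n. N \<le> n \<Longrightarrow> d (c t) (c (grid T n t)) < \<delta>"
      using near[OF x(1) \<delta>(1)] unfolding eventually_sequentially by blast
    then have "t \<in> H k n" if "N \<le> n" for n using \<delta>(2)[OF cX[OF grid(3)[OF x(1)]]] that x(1) by (simp add: H_def)
    then show "t \<in> (\<Union>k N. \<Inter>n\<in>{N..}. H k n)" by blast
  next
    fix t assume "t \<in> (\<Union>k N. \<Inter>n\<in>{N..}. H k n)"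
    then obtain k N where t: "\<And>n. N \<le> n \<Longrightarrow> t \<in> H k n" by auto
    have t0: "t \<in> {0..T}" using t[of N] by (simp add: H_def)
    have "F t (c t) \<inter> W \<noteq> {}"
    proof
      assume "F t (c t) \<inter> W = {}"
      then have Ck: "open (- C k) \<and> F t (c t) \<subseteq> - C k" using C[of k] C_sub[of k] open_Compl by blast
      have "setmap_usc X d (F t)" using cont[OF t0] by (simp add: setmap_continuous_def)
      from this[unfolded setmap_usc_def, rule_format, OF cX[OF t0] Ck]
      obtain \<delta> where \<delta>: "0 < \<delta>" "\<And>y. y \<in> X \<Longrightarrow> d (c t) y < \<delta> \<Longrightarrow> F t y \<subseteq> - C k" by blast
      obtain n where n: "N \<le> n" "d (c t) (c (grid T n t)) < \<delta>"
        using near[OF t0 \<delta>(1)] unfolding eventually_sequentially by (metis nle_le)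
      have "F t (c (grid T n t)) \<subseteq> - C k" using \<delta>(2)[OF cX[OF grid(3)[OF t0]] n(2)] .
      then show False using t[OF n(1)] G(2)[of k] by (auto simp: H_def)
    qed
    then show "t \<in> {t \<in> {0..T}. F t (c t) \<inter> W \<noteq> {}}" using t0 by simp
  qed
  also have "\<dots> \<in> sets lebesgue" using H by (intro sets.countable_UN sets.countable_INT'' image_subsetI) auto
  finally show "{t \<in> {0..T}. F t (c t) \<inter> W \<noteq> {}} \<in> sets lebesgue" .
qed

section \<open>Measurability of vector fields along curves and controls\<close>

lemma norm_le_C0_norm:
  assumes "compact K" "continuous_on K f" "x \<in> K"
  shows "norm (f x) \<le> C0_norm K f"
proof -
  have "bounded ((\<lambda>x. norm (f x)) ` K)"
    using assms by (intro compact_imp_bounded compact_continuous_image continuous_intros)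
  then show ?thesis unfolding C0_norm_def using assms(3) by (intro cSUP_upper bounded_imp_bdd_above)
qed

lemma borel_measurable_AE_lim:
  fixes f :: "nat \<Rightarrow> 'a \<Rightarrow> 'b::{banach, second_countable_topology}"
  assumes "complete_measure M" and f: "\<And>n. f n \<in> borel_measurable M"
    and lim: "AE x in M. (\<lambda>n. f n x) \<longlonglongrightarrow> g x"
  shows "g \<in> borel_measurable M"
proof (rule AE_measurable_complete[OF assms(1)])
  show "(\<lambda>x. lim (\<lambda>n. f n x)) \<in> borel_measurable M" using f by (rule borel_measurable_lim_metric)
  show "AE x in M. lim (\<lambda>n. f n x) = g x" using lim by eventually_elim (rule limI)
qed auto

text \<open>
  The supports of an absolutely continuous curve need not lie in a common compact set, so the curve is
  truncated to balls before the Lipschitz condition in \<open>\<mu>\<close> is used.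
\<close>
lemma measurable_field_along_curve:
  fixes h :: "real \<Rightarrow> (real ^ 'n) measure \<Rightarrow> real ^ 'n \<Rightarrow> real ^ 'n"
  assumes "0 \<le> T" and \<mu>: "\<mu> \<in> AC_curves T probs_c W1"
    and C0: "\<And>t \<nu>. t \<in> {0..T} \<Longrightarrow> \<nu> \<in> probs_c \<Longrightarrow> h t \<nu> \<in> C0"
    and meas: "\<And>\<nu>. \<nu> \<in> probs_c \<Longrightarrow> (\<lambda>t. h t \<nu> x) \<in> borel_measurable (lebesgue_on {0..T})"
    and Lip: "\<And>K. compact K \<Longrightarrow> \<exists>L \<in> L1_nonneg T. AE t in lebesgue_on {0..T}.
       \<forall>\<nu>\<in>probs_on K. \<forall>\<nu>'\<in>probs_on K. C0_norm K (\<lambda>x. h t \<nu> x - h t \<nu>' x) \<le> L t * W1 \<nu> \<nu>'"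
  shows "(\<lambda>t. h t (\<mu> t) x) \<in> borel_measurable (lebesgue_on {0..T})"
proof -
  have \<mu>c: "\<mu> t \<in> probs_c" if "t \<in> {0..T}" for t using \<mu> that by (auto simp: AC_curves_def)
  then have \<mu>b: "\<mu> t \<in> borel_probs" if "t \<in> {0..T}" for t using that by (auto simp: probs_c_def)
  \<comment> \<open>A uniform bound on a ball says something about the value at \<open>x\<close>
    only if the ball contains \<open>x\<close>, so the truncation radii start beyond the norm of
    \<open>x\<close>.\<close>
  obtain R0 :: nat where R0: "norm x \<le> R0" using real_arch_simple by blast
  have trunc: "(\<lambda>t. h t (truncate R (\<mu> t)) x) \<in> borel_measurable (lebesgue_on {0..T})"
    if R: "norm x \<le> R" for R
  proof (rule borel_measurable_AE_lim)
    have "0 \<le> R" using order_trans[OF norm_ge_zero R] .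
    have on: "truncate R (\<mu> t) \<in> probs_on (cball 0 R)" if "t \<in> {0..T}" for t
      using truncate_in_probs_on[OF \<open>0 \<le> R\<close> \<mu>b[OF that]] .
    have pc: "truncate R (\<mu> t) \<in> probs_c" if "t \<in> {0..T}" for t
      using on[OF that] probs_on_subset_probs_c[OF compact_cball] by blast
    show "complete_measure (lebesgue_on {0..T})" by (rule complete_measure_lebesgue_on) simp
    show "(\<lambda>t. h t (truncate R (\<mu> (grid T n t))) x) \<in> borel_measurable (lebesgue_on {0..T})" for n
      using meas[OF pc] by (intro measurable_grid[OF \<open>0 \<le> T\<close>, where f = "\<lambda>s t. h t (truncate R (\<mu> s)) x"])
    obtain L where L: "L \<in> L1_nonneg T" and Lip: "AE t in lebesgue_on {0..T}.
       \<forall>\<nu>\<in>probs_on (cball 0 R). \<forall>\<nu>'\<in>probs_on (cball 0 R). C0_norm (cball 0 R) (\<lambda>x. h t \<nu> x - h t \<nu>' x) \<le> L t * W1 \<nu> \<nu>'"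
      using Lip[OF compact_cball] by blast
    show "AE t in lebesgue_on {0..T}. (\<lambda>n. h t (truncate R (\<mu> (grid T n t))) x) \<longlonglongrightarrow> h t (truncate R (\<mu> t)) x"
      using Lip
    proof (rule AE_mp, intro AE_I2 impI)
      fix t assume "t \<in> space (lebesgue_on {0..T})"
        and lip: "\<forall>\<nu>\<in>probs_on (cball 0 R). \<forall>\<nu>'\<in>probs_on (cball 0 R). C0_norm (cball 0 R) (\<lambda>x. h t \<nu> x - h t \<nu>' x) \<le> L t * W1 \<nu> \<nu>'"
      then have t: "t \<in> {0..T}" by simp
      have "0 \<le> L t" using L t by (simp add: L1_nonneg_def)
      have bound: "dist (h t (truncate R (\<mu> (grid T n t))) x) (h t (truncate R (\<mu> t)) x) \<le> L t * W1 (\<mu> t) (\<mu> (grid T n t))" for n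
      proof -
        let ?\<nu> = "truncate R (\<mu> t)" and ?\<nu>' = "truncate R (\<mu> (grid T n t))"
        note s = grid(3)[OF t, of n]
        have "continuous_on (cball 0 R) (\<lambda>x. h t ?\<nu> x - h t ?\<nu>' x)"
          using C0[OF t pc[OF t]] C0[OF t pc[OF s]]
          by (intro continuous_intros) (auto simp: C0_def intro: continuous_on_subset)
        then have "norm (h t ?\<nu> x - h t ?\<nu>' x) \<le> C0_norm (cball 0 R) (\<lambda>x. h t ?\<nu> x - h t ?\<nu>' x)"
          using R by (intro norm_le_C0_norm compact_cball) auto
        also have "\<dots> \<le> L t * W1 ?\<nu> ?\<nu>'" using lip on[OF t] on[OF s] by blast
        also have "\<dots> \<le> L t * W1 (\<mu> t) (\<mu> (grid T n t))"
          using \<open>0 \<le> L t\<close> \<open>0 \<le> R\<close> \<mu>c t s by (intro mult_left_mono W1_truncate_le) auto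
        finally show ?thesis by (simp add: dist_norm norm_minus_commute)
      qed
      show "(\<lambda>n. h t (truncate R (\<mu> (grid T n t))) x) \<longlonglongrightarrow> h t (truncate R (\<mu> t)) x"
      proof (rule tendstoI)
        fix e :: real assume "0 < e"
        \<comment> \<open>The added 1 keeps \<delta> positive when \<open>L t\<close> is 0.\<close>
        define \<delta> where "\<delta> = e / (L t + 1)"
        have "0 < \<delta>" using \<open>0 < e\<close> \<open>0 \<le> L t\<close> by (simp add: \<delta>_def)
        have small: "L t * \<delta> < e" using \<open>0 < e\<close> \<open>0 \<le> L t\<close> by (simp add: \<delta>_def field_simps)
        have "eventually (\<lambda>n. W1 (\<mu> t) (\<mu> (grid T n t)) < \<delta>) sequentially"
          using \<mu> grid[OF t] t \<open>0 < \<delta>\<close> by (intro AC_curve_right_continuous) auto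
        then show "eventually (\<lambda>n. dist (h t (truncate R (\<mu> (grid T n t))) x) (h t (truncate R (\<mu> t)) x) < e) sequentially"
        proof eventually_elim
          case (elim n)
          then have "L t * W1 (\<mu> t) (\<mu> (grid T n t)) \<le> L t * \<delta>" using \<open>0 \<le> L t\<close> by (intro mult_left_mono) auto
          then show ?case using bound[of n] small by linarith
        qed
      qed
    qed
  qed
  show ?thesis
  proof (rule borel_measurable_LIMSEQ_metric)
    fix k :: nat
    show "(\<lambda>t. h t (truncate (real (R0 + k)) (\<mu> t)) x) \<in> borel_measurable (lebesgue_on {0..T})"
      using R0 by (intro trunc) auto
  next
    fix t assume "t \<in> space (lebesgue_on {0..T})"
    then have t: "t \<in> {0..T}" by simp
    have "compact (msupp (\<mu> t))" using \<mu>c[OF t] by (simp add: probs_c_def)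
    then have "bounded (msupp (\<mu> t))" by (rule compact_imp_bounded)
    then obtain B where B: "\<And>y. y \<in> msupp (\<mu> t) \<Longrightarrow> norm y \<le> B"
      unfolding bounded_iff by blast
    obtain k0 :: nat where k0: "B \<le> k0" using real_arch_simple by blast
    \<comment> \<open>The index \<open>k0\<close> depends on \<open>t\<close>, which is enough for a
      pointwise limit.\<close>
    have "truncate (real (R0 + k)) (\<mu> t) = \<mu> t" if "k0 \<le> k" for k
    proof (rule truncate_eq)
      have "norm y \<le> real (R0 + k)" if "y \<in> msupp (\<mu> t)" for y
        using B[OF that] k0 \<open>k0 \<le> k\<close> by simp
      then show "\<mu> t \<in> probs_on (cball 0 (real (R0 + k)))"
        using \<mu>b[OF t] by (auto simp: probs_on_def)
    qed simp
    then have "eventually (\<lambda>k. h t (truncate (real (R0 + k)) (\<mu> t)) x = h t (\<mu> t) x) sequentially"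
      unfolding eventually_sequentially by (intro exI[of _ k0]) auto
    then show "(\<lambda>k. h t (truncate (real (R0 + k)) (\<mu> t)) x) \<longlonglongrightarrow> h t (\<mu> t) x"
      by (rule tendsto_eventually)
  qed
qed

text \<open>The map \<open>u\<close> is approximated by the countably valued maps that pick the
  first point of an enumeration of \<open>D\<close> within 1 / (n + 1) of \<open>u t\<close>.
  Composition with each of them is measurable piece by piece, and continuity of \<open>g t\<close>
  gives the limit at almost every time.\<close>

lemma measurable_caratheodory_compose:
  fixes g :: "'t \<Rightarrow> 'u::metric_space \<Rightarrow> 'b::{banach, second_countable_topology}"
  assumes "complete_measure M" and D: "countable D" and sep: "AE t in M. u t \<in> closure D"
    and u: "u \<in> borel_measurable M" and meas: "\<And>y. (\<lambda>t. g t y) \<in> borel_measurable M"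
    and cont: "\<And>t. t \<in> space M \<Longrightarrow> continuous_on UNIV (g t)"
  shows "(\<lambda>t. g t (u t)) \<in> borel_measurable M"
proof (rule borel_measurable_AE_lim[OF assms(1)])
  define d where "d = from_nat_into D"
  define i where "i n t = (LEAST i. u t \<in> ball (d i) (1 / Suc n))" for n t
  have "(\<lambda>t. i n t) \<in> measurable M (count_space UNIV)" for n
    unfolding i_def
  proof (rule measurable_Least)
    fix j
    have "u -` ball (d j) (1 / Suc n) \<inter> space M \<in> sets M" using u by (rule measurable_sets) simp
    moreover have "u -` ball (d j) (1 / Suc n) \<inter> space M = {t \<in> space M. u t \<in> ball (d j) (1 / Suc n)}" by auto
    ultimately show "Measurable.pred M (\<lambda>t. u t \<in> ball (d j) (1 / Suc n))"
      unfolding pred_def by (simp only:)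
  qed
  then show "(\<lambda>t. g t (d (i n t))) \<in> borel_measurable M" for n
    by (rule measurable_compose_countable[where f = "\<lambda>i t. g t (d i)", OF meas])
  show "AE t in M. (\<lambda>n. g t (d (i n t))) \<longlonglongrightarrow> g t (u t)"
    using sep
  proof (rule AE_mp, intro AE_I2 impI)
    fix t assume t: "t \<in> space M" "u t \<in> closure D"
    have near: "dist (d (i n t)) (u t) < 1 / Suc n" for n
    proof -
      obtain y where "y \<in> D" "dist y (u t) < 1 / Suc n"
        using t(2) unfolding closure_approachable by (meson of_nat_0_less_iff zero_less_Suc zero_less_divide_1_iff)
      then obtain j where "u t \<in> ball (d j) (1 / Suc n)"
        using from_nat_into_surj[OF D] by (metis d_def mem_ball)
      then have "u t \<in> ball (d (i n t)) (1 / Suc n)" unfolding i_def by (rule LeastI)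
      then show ?thesis by simp
    qed
    have "(\<lambda>n. d (i n t)) \<longlonglongrightarrow> u t"
    proof (rule metric_LIMSEQ_I)
      fix e :: real assume "0 < e"
      then obtain N where N: "1 / Suc N < e" using nat_approx_posE by blast
      have "dist (d (i n t)) (u t) < e" if "N \<le> n" for n
      proof -
        have "1 / Suc n \<le> 1 / Suc N" using that by (simp add: frac_le)
        then show ?thesis using near[of n] N by linarith
      qed
      then show "\<exists>N. \<forall>n\<ge>N. dist (d (i n t)) (u t) < e" by blast
    qed
    then show "(\<lambda>n. g t (d (i n t))) \<longlonglongrightarrow> g t (u t)"
      using continuous_on_tendsto_compose[OF cont[OF t(1)]] by auto
  qed
qed

section \<open>Filippov selection\<close>

text \<open>The controls that reproduce \<open>w t\<close> form a compact set \<open>G t\<close>,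
  described by equations at a countable dense set of points \<open>x j\<close>. Measurability of
  \<open>g\<close> is known only for a fixed control, so exact solutions in a closed set
  \<open>C\<close> are replaced by approximate ones from an enumeration \<open>d\<close>: for each
  \<open>n\<close>, some \<open>d i\<close> lies within 1 / (n + 1) of \<open>F t\<close>
  intersected with \<open>C\<close> and solves the first n + 1 equations up to 1 / (n + 1).
  Compactness turns such approximants into an exact solution in \<open>C\<close>.\<close>

lemma filippov_selection:
  fixes g :: "'t \<Rightarrow> 'u::metric_space \<Rightarrow> 'a::second_countable_topology \<Rightarrow> 'b::{metric_space, second_countable_topology}"
  assumes D: "countable D"
    and F: "\<And>t. t \<in> space M \<Longrightarrow> compact (F t)" "\<And>t. t \<in> space M \<Longrightarrow> F t \<subseteq> closure D"
    and hit: "\<And>C. closed C \<Longrightarrow> {t \<in> space M. F t \<inter> C \<noteq> {}} \<in> sets M"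
    and g_meas: "\<And>u x. (\<lambda>t. g t u x) \<in> borel_measurable M"
    and g_cont_u: "\<And>t x. t \<in> space M \<Longrightarrow> continuous_on UNIV (\<lambda>u. g t u x)"
    and g_C0: "\<And>t u. t \<in> space M \<Longrightarrow> g t u \<in> C0"
    and w_meas: "\<And>x. (\<lambda>t. w t x) \<in> borel_measurable M"
    and w: "\<And>t. t \<in> space M \<Longrightarrow> w t \<in> g t ` F t"
  shows "\<exists>u \<in> borel_measurable M. \<forall>t\<in>space M. u t \<in> F t \<and> g t (u t) = w t"
proof -
  obtain X :: "'a set" where X: "countable X" "\<And>S. open S \<Longrightarrow> S \<noteq> {} \<Longrightarrow> \<exists>x\<in>X. x \<in> S"
    by (rule countable_dense_setE) blast
  define x where "x = from_nat_into X"
  have X_sub: "X \<subseteq> range x" unfolding x_def using X(1) by (metis UNIV_I from_nat_into_surj image_eqI subsetI)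
  define d where "d = from_nat_into D"
  have D_sub: "D \<subseteq> range d" unfolding d_def using D by (metis UNIV_I from_nat_into_surj image_eqI subsetI)
  have g_eq: "g t u = w t" if t: "t \<in> space M" and eq: "\<And>j. g t u (x j) = w t (x j)" for t u
  proof (rule ccontr)
    assume "g t u \<noteq> w t"
    then have "{y. g t u y \<noteq> w t y} \<noteq> {}" by auto
    moreover have "w t \<in> C0" using w[OF t] g_C0[OF t] by auto
    then have "open {y. g t u y \<noteq> w t y}"
      using g_C0[OF t, of u] by (intro open_Collect_neq) (auto simp: C0_def)
    ultimately obtain y where y: "y \<in> X" "g t u y \<noteq> w t y" using X(2) by blast
    then obtain j where "y = x j" using X_sub by blast
    then show False using eq y(2) by simp
  qed
  define G where "G t = F t \<inter> (\<Inter>j. {u. g t u (x j) = w t (x j)})" for t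
  have G_eq: "G t = {u \<in> F t. g t u = w t}" if "t \<in> space M" for t
    unfolding G_def using g_eq[OF that] by auto
  have "\<exists>u \<in> borel_measurable M. \<forall>t\<in>space M. u t \<in> G t"
  proof (rule compact_setmap_selection[OF D])
    fix t assume t: "t \<in> space M"
    show "compact (G t)"
      unfolding G_def by (intro compact_Int_closed F(1) t closed_INT ballI closed_Collect_eq g_cont_u continuous_on_const)
    show "G t \<noteq> {}" using w[OF t] by (auto simp: G_eq[OF t])
    show "G t \<subseteq> closure D" using F(2)[OF t] by (auto simp: G_def)
  next
    fix C :: "'u set" assume C: "closed C"
    define A where "A n i = {t \<in> space M. F t \<inter> (C \<inter> cball (d i) (1 / Suc n)) \<noteq> {}}" for n i
    define B where "B n i = {t \<in> space M. \<forall>j\<in>{..n}. dist (g t (d i) (x j)) (w t (x j)) < 1 / Suc n}" for n i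
    have A: "A n i \<in> sets M" for n i unfolding A_def using C by (intro hit) auto
    have B: "B n i \<in> sets M" for n i
      unfolding B_def
    proof (rule sets.sets_Collect_countable_All')
      show "{t \<in> space M. dist (g t (d i) (x j)) (w t (x j)) < 1 / Suc n} \<in> sets M" for j
        using g_meas w_meas by (intro borel_measurable_less borel_measurable_dist) auto
    qed (auto intro: countable_finite)
    have "{t \<in> space M. G t \<inter> C \<noteq> {}} = (\<Inter>n. \<Union>i. A n i \<inter> B n i)"
    proof (intro equalityI subsetI INT_I)
      fix t n assume "t \<in> {t \<in> space M. G t \<inter> C \<noteq> {}}"
      then obtain u where u: "t \<in> space M" "u \<in> F t" "g t u = w t" "u \<in> C" using G_eq by blast
      \<comment> \<open>An exact solution \<open>u\<close> may lie outside \<open>D\<close>, but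
        every point of \<open>D\<close> in this neighbourhood of \<open>u\<close> satisfies both
        requirements at accuracy \<open>n\<close>.\<close>
      define W where "W = ball u (1 / Suc n) \<inter> (\<Inter>j\<in>{..n}. {y. dist (g t y (x j)) (w t (x j)) < 1 / Suc n})"
      have "open W"
        unfolding W_def using g_cont_u[OF u(1)]
        by (intro open_Int open_INT ballI open_Collect_less continuous_intros) auto
      moreover have "u \<in> W" using u(3) by (simp add: W_def)
      moreover have "u \<in> closure D" using F(2)[OF u(1)] u(2) by blast
      ultimately have "D \<inter> W \<noteq> {}" by (meson disjoint_iff open_Int_closure_eq_empty inf_commute)
      then obtain i where i: "d i \<in> W" using D_sub by blast
      have "t \<in> A n i" using u i by (auto simp: A_def W_def dist_commute intro!: less_imp_le)
      moreover have "t \<in> B n i" using u(1) i by (auto simp: B_def W_def)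
      ultimately show "t \<in> (\<Union>i. A n i \<inter> B n i)" by blast
    next
      fix t assume t: "t \<in> (\<Inter>n. \<Union>i. A n i \<inter> B n i)"
      then have tM: "t \<in> space M" by (auto simp: A_def)
      have "\<forall>n. \<exists>i u. t \<in> B n i \<and> u \<in> F t \<inter> C \<and> dist (d i) u \<le> 1 / Suc n"
        using t by (fastforce simp: A_def)
      then obtain i u where iu: "\<And>n. t \<in> B n (i n)" "\<And>n. u n \<in> F t \<inter> C" "\<And>n. dist (d (i n)) (u n) \<le> 1 / Suc n"
        by metis
      have "compact (F t \<inter> C)" using F(1)[OF tM] C by (rule compact_Int_closed)
      then obtain l r where l: "l \<in> F t \<inter> C" and r: "strict_mono r" and lim: "(u \<circ> r) \<longlonglongrightarrow> l"
        using iu(2) unfolding compact_def by meson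
      have null: "(\<lambda>n. 1 / real (Suc (r n))) \<longlonglongrightarrow> 0"
        using LIMSEQ_subseq_LIMSEQ[OF LIMSEQ_inverse_real_of_nat r] by (simp add: o_def inverse_eq_divide)
      have "(\<lambda>n. dist (d (i (r n))) (u (r n))) \<longlonglongrightarrow> 0"
        by (rule tendsto_sandwich[OF _ _ tendsto_const null]) (use iu(3) in auto)
      from tendsto_add[OF this tendsto_dist[OF lim[unfolded o_def] tendsto_const[of l]]]
      have sum: "(\<lambda>n. dist (d (i (r n))) (u (r n)) + dist (u (r n)) l) \<longlonglongrightarrow> 0" by simp
      have "(\<lambda>n. dist (d (i (r n))) l) \<longlonglongrightarrow> 0"
        by (rule tendsto_sandwich[OF _ _ tendsto_const sum]) (simp_all add: dist_triangle)
      then have d_lim: "(\<lambda>n. d (i (r n))) \<longlonglongrightarrow> l" by (rule tendsto_dist_iff[THEN iffD2])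
      have "g t l (x j) = w t (x j)" for j
      proof -
        have "(\<lambda>n. g t (d (i (r n))) (x j)) \<longlonglongrightarrow> g t l (x j)"
          using continuous_on_tendsto_compose[OF g_cont_u[OF tM] d_lim] by simp
        then have 1: "(\<lambda>n. dist (g t (d (i (r n))) (x j)) (w t (x j))) \<longlonglongrightarrow> dist (g t l (x j)) (w t (x j))"
          by (intro tendsto_dist tendsto_const)
        have "dist (g t (d (i (r n))) (x j)) (w t (x j)) \<le> 1 / real (Suc (r n))" if "j \<le> n" for n
        proof -
          have "j \<le> r n" using that seq_suble[OF r, of n] by simp
          then show ?thesis using iu(1)[of "r n"] by (auto simp: B_def intro: less_imp_le)
        qed
        then have "dist (g t l (x j)) (w t (x j)) \<le> 0"
          by (intro LIMSEQ_le[OF 1 null]) blast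
        then show ?thesis by simp
      qed
      then have "l \<in> G t \<inter> C" using l by (simp add: G_def)
      then show "t \<in> {t \<in> space M. G t \<inter> C \<noteq> {}}" using tM by blast
    qed
    also have "\<dots> \<in> sets M" using A B by (intro sets.countable_INT sets.countable_UN image_subsetI sets.Int) auto
    finally show "{t \<in> space M. G t \<inter> C \<noteq> {}} \<in> sets M" .
  qed
  then show ?thesis using G_eq by blast
qed

text \<open>The field enters the weak equation only under the integral over time. Completeness of
  Lebesgue measure keeps the inner integral measurable after a change on a null set of
  times.\<close>

lemma solves_continuity_eq_AE_cong:
  assumes w: "solves_continuity_eq T w \<mu>0 \<mu>"
    and ae: "AE t in lebesgue_on {0..T}. w t = w' t"
  shows "solves_continuity_eq T w' \<mu>0 \<mu>"
  unfolding solves_continuity_eq_def Let_def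
proof (intro conjI ballI)
  let ?M = "lebesgue_on {0..T}"
  show "\<mu> \<in> AC_curves T probs_c W1" "\<mu> 0 = \<mu>0" using w by (auto simp: solves_continuity_eq_def)
  fix \<phi> :: "real \<times> 'a \<Rightarrow> real" assume \<phi>: "\<phi> \<in> test_functions T"
  define g where "g = (\<lambda>w t x. deriv (\<lambda>s. \<phi> (s, x)) t + grad (\<lambda>y. \<phi> (t, y)) x \<bullet> w t x)"
  have 1: "AE t in ?M. integrable (\<mu> t) (g w t)" and 2: "integrable ?M (\<lambda>t. \<integral>x. g w t x \<partial>\<mu> t)"
    and 3: "(\<integral>t. (\<integral>x. g w t x \<partial>\<mu> t) \<partial>?M) = 0"
    using w \<phi> by (auto simp: solves_continuity_eq_def Let_def g_def)
  have "AE t in ?M. integrable (\<mu> t) (g w' t)" using 1 ae by eventually_elim (simp add: g_def)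
  then show "AE t in ?M. integrable (\<mu> t) (\<lambda>x. deriv (\<lambda>s. \<phi> (s, x)) t + grad (\<lambda>y. \<phi> (t, y)) x \<bullet> w' t x)"
    by (simp add: g_def)
  have eq: "AE t in ?M. (\<integral>x. g w t x \<partial>\<mu> t) = (\<integral>x. g w' t x \<partial>\<mu> t)" using ae by eventually_elim (simp add: g_def)
  have meas: "(\<lambda>t. \<integral>x. g w' t x \<partial>\<mu> t) \<in> borel_measurable ?M"
    by (rule AE_measurable_complete[OF complete_measure_lebesgue_on borel_measurable_integrable[OF 2] eq]) auto
  have "integrable ?M (\<lambda>t. \<integral>x. g w' t x \<partial>\<mu> t)" by (rule integrable_cong_AE_imp[OF 2 meas eq])
  then show "integrable ?M (\<lambda>t. \<integral>x. deriv (\<lambda>s. \<phi> (s, x)) t + grad (\<lambda>y. \<phi> (t, y)) x \<bullet> w' t x \<partial>\<mu> t)"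
    by (simp add: g_def)
  have "(\<integral>t. (\<integral>x. g w' t x \<partial>\<mu> t) \<partial>?M) = 0"
    using integral_cong_AE[OF borel_measurable_integrable[OF 2] meas eq] 3 by simp
  then show "(\<integral>t. (\<integral>x. deriv (\<lambda>s. \<phi> (s, x)) t + grad (\<lambda>y. \<phi> (t, y)) x \<bullet> w' t x \<partial>\<mu> t) \<partial>?M) = 0"
    by (simp add: g_def)
qed

theorem proposition2:
  fixes T :: real
    and \<mu>0 :: "(real ^ 'n) measure"
    and U :: "real \<Rightarrow> (real ^ 'n) measure \<Rightarrow> 'u::metric_space set"
    and v :: "real \<Rightarrow> (real ^ 'n) measure \<Rightarrow> 'u \<Rightarrow> real ^ 'n \<Rightarrow> real ^ 'n"
    and V :: "real \<Rightarrow> (real ^ 'n) measure \<Rightarrow> (real ^ 'n \<Rightarrow> real ^ 'n) set"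
    and \<mu> :: "real \<Rightarrow> (real ^ 'n) measure"
  assumes T_pos: "0 < T"
    and mu0: "\<mu>0 \<in> probs_c"
    and U_compact: "\<And>t \<mu>. t \<in> {0..T} \<Longrightarrow> \<mu> \<in> probs_c \<Longrightarrow> compact (U t \<mu>)"
    and v_C0: "\<And>t \<mu> u. t \<in> {0..T} \<Longrightarrow> \<mu> \<in> probs_c \<Longrightarrow> v t \<mu> u \<in> C0"
    and U_measurable: "\<And>\<mu>. \<mu> \<in> probs_c \<Longrightarrow> setmap_measurable T (\<lambda>t. U t \<mu>)"
    and U_continuous: "\<And>t. t \<in> {0..T} \<Longrightarrow> setmap_continuous probs_c W1 (U t)"
    and v_measurable: "\<And>\<mu> u x. \<mu> \<in> probs_c \<Longrightarrow>
          (\<lambda>t. v t \<mu> u x) \<in> borel_measurable (lebesgue_on {0..T})"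
    and v_continuous: "\<And>t \<mu>. t \<in> {0..T} \<Longrightarrow> \<mu> \<in> probs_c \<Longrightarrow>
          continuous_on UNIV (\<lambda>(u, x). v t \<mu> u x)"
    and v_growth: "\<exists>m \<in> L1_nonneg T. AE t in lebesgue_on {0..T}.
          \<forall>\<mu>\<in>probs_c. \<forall>u x. norm (v t \<mu> u x) \<le> m t * (1 + norm x + moment1 \<mu>)"
    and v_Lipschitz: "\<And>K. compact K \<Longrightarrow> \<exists>l \<in> L1_nonneg T. \<exists>L \<in> L1_nonneg T.
          (AE t in lebesgue_on {0..T}. \<forall>\<mu>\<in>probs_on K. \<forall>u. (l t)-lipschitz_on K (v t \<mu> u)) \<and>
          (AE t in lebesgue_on {0..T}. \<forall>\<mu>\<in>probs_on K. \<forall>\<nu>\<in>probs_on K. \<forall>u.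
             C0_norm K (\<lambda>x. v t \<mu> u x - v t \<nu> u x) \<le> L t * W1 \<mu> \<nu>)"
    and V_def: "\<And>t \<mu>. V t \<mu> = v t \<mu> ` U t \<mu>"
  shows "solves_inclusion T V \<mu>0 \<mu> \<longleftrightarrow>
         (\<exists>u. measurable_selection T borel (\<lambda>t. U t (\<mu> t)) u \<and>
              solves_continuity_eq T (\<lambda>t x. v t (\<mu> t) (u t) x) \<mu>0 \<mu>)"
proof (cases "\<mu> \<in> AC_curves T probs_c W1")
  \<comment> \<open>Absolute continuity of the curve is part of being a solution, so both sides
    fail.\<close>
  case False
  then show ?thesis by (auto simp: solves_inclusion_def solves_continuity_eq_def)
next
  case AC: True
  let ?M = "lebesgue_on {0..T}"
  define F where "F t = U t (\<mu> t)" for t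
  define g where "g t = v t (\<mu> t)" for t
  have complete: "complete_measure ?M" by (rule complete_measure_lebesgue_on) simp
  have T0: "0 \<le> T" using T_pos by simp
  have \<mu>c: "\<mu> t \<in> probs_c" if "t \<in> {0..T}" for t using AC that by (auto simp: AC_curves_def)
  have F_compact: "compact (F t)" if "t \<in> {0..T}" for t unfolding F_def by (intro U_compact \<mu>c that)
  have F_meas: "setmap_measurable T F"
    unfolding F_def by (rule setmap_measurable_along_curve[OF T0 AC U_measurable U_continuous])
  obtain D where D: "countable D" "AE t in ?M. F t \<subseteq> closure D"
    using setmap_ess_separable[OF F_meas F_compact] by blast
  have g_C0: "g t u \<in> C0" if "t \<in> {0..T}" for t u unfolding g_def by (intro v_C0 \<mu>c that)
  have g_cont: "continuous_on UNIV (\<lambda>u. g t u x)" if "t \<in> {0..T}" for t x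
    using continuous_on_compose2[OF v_continuous[OF that \<mu>c[OF that]], of UNIV "\<lambda>u. (u, x)"]
    by (simp add: g_def continuous_on_Pair)
  have g_meas: "(\<lambda>t. g t u x) \<in> borel_measurable ?M" for u x
    unfolding g_def
  proof (rule measurable_field_along_curve[OF T0 AC])
    fix K :: "(real ^ 'n) set" assume "compact K"
    from v_Lipschitz[OF this] obtain L where L: "L \<in> L1_nonneg T" and ae: "AE t in ?M.
        \<forall>\<mu>\<in>probs_on K. \<forall>\<nu>\<in>probs_on K. \<forall>u. C0_norm K (\<lambda>x. v t \<mu> u x - v t \<nu> u x) \<le> L t * W1 \<mu> \<nu>" by blast
    from ae have "AE t in ?M. \<forall>\<nu>\<in>probs_on K. \<forall>\<nu>'\<in>probs_on K. C0_norm K (\<lambda>x. v t \<nu> u x - v t \<nu>' u x) \<le> L t * W1 \<nu> \<nu>'"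
      by eventually_elim blast
    then show "\<exists>L \<in> L1_nonneg T. AE t in ?M. \<forall>\<nu>\<in>probs_on K. \<forall>\<nu>'\<in>probs_on K.
        C0_norm K (\<lambda>x. v t \<nu> u x - v t \<nu>' u x) \<le> L t * W1 \<nu> \<nu>'" using L by blast
  qed (auto intro: v_C0 v_measurable)
  show ?thesis
  proof
    assume "solves_inclusion T V \<mu>0 \<mu>"
    then obtain w where w: "w \<in> measurable ?M C0_borel" "AE t in ?M. w t \<in> V t (\<mu> t)"
      and sol: "solves_continuity_eq T w \<mu>0 \<mu>"
      unfolding solves_inclusion_def measurable_selection_def by blast
    from w(2) D(2) have "AE t in ?M. w t \<in> g t ` F t \<and> F t \<subseteq> closure D"
      by eventually_elim (simp add: V_def g_def F_def)
    then obtain N where N_sub: "{t \<in> space ?M. \<not> (w t \<in> g t ` F t \<and> F t \<subseteq> closure D)} \<subseteq> N"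
      and "emeasure ?M N = 0" "N \<in> sets ?M"
      by (rule AE_E)
    then have N: "N \<in> null_sets ?M" by (intro null_setsI)
    \<comment> \<open>The selection argument asks for its hypotheses at every time, so a measurable
      null set containing all exceptional times is discarded first.\<close>
    define S where "S = {0..T} - N"
    have "N \<in> sets lebesgue" using N by (auto simp: null_sets_def sets_restrict_space_iff)
    then have S: "S \<in> sets lebesgue" "S \<subseteq> {0..T}" by (auto simp: S_def)
    have good: "w t \<in> g t ` F t" "F t \<subseteq> closure D" if "t \<in> S" for t
      using N_sub that by (auto simp: S_def)
    have "\<exists>u \<in> borel_measurable (lebesgue_on S). \<forall>t\<in>space (lebesgue_on S). u t \<in> F t \<and> g t (u t) = w t"
    proof (rule filippov_selection[OF D(1)])
      fix C :: "'u set" assume "closed C"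
      have "{t \<in> {0..T}. F t \<inter> C \<noteq> {}} \<in> sets lebesgue"
        by (rule hit_closed_measurable[OF F_compact _ \<open>closed C\<close>])
          (use F_meas in \<open>simp_all add: setmap_measurable_def\<close>)
      then have "S \<inter> {t \<in> {0..T}. F t \<inter> C \<noteq> {}} \<in> sets lebesgue" using S(1) by (rule sets.Int[rotated])
      moreover have "S \<inter> {t \<in> {0..T}. F t \<inter> C \<noteq> {}} = {t \<in> space (lebesgue_on S). F t \<inter> C \<noteq> {}}" using S(2) by auto
      ultimately show "{t \<in> space (lebesgue_on S). F t \<inter> C \<noteq> {}} \<in> sets (lebesgue_on S)"
        using S(1) by (auto simp: sets_restrict_space_iff)
    next
      show "(\<lambda>t. g t u x) \<in> borel_measurable (lebesgue_on S)" for u x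
        using g_meas S(2) by (rule measurable_restrict_mono)
      show "(\<lambda>t. w t x) \<in> borel_measurable (lebesgue_on S)" for x
        using measurable_eval_C0_borel[OF w(1)] S(2) by (rule measurable_restrict_mono)
    qed (use good S F_compact g_C0 g_cont in auto)
    then obtain u where u: "u \<in> borel_measurable (lebesgue_on S)" "\<And>t. t \<in> S \<Longrightarrow> u t \<in> F t \<and> g t (u t) = w t"
      by auto
    \<comment> \<open>On the discarded null set any constant value serves: an admissible control has
      to lie in the control set only at almost every time.\<close>
    define u' where "u' t = (if t \<in> S then u t else undefined)" for t
    have "u' \<in> borel_measurable ?M"
      unfolding u'_def
    proof (subst measurable_If_restrict_space_iff)
      have "{t \<in> space ?M. t \<in> S} = S" using S(2) by auto
      then show "{t \<in> space ?M. t \<in> S} \<in> sets ?M" using S by (simp add: sets_restrict_space_iff)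
      have "restrict_space ?M {t. t \<in> S} = lebesgue_on S"
        using S by (simp add: restrict_restrict_space Int_absorb1)
      then show "u \<in> borel_measurable (restrict_space ?M {t. t \<in> S}) \<and>
          (\<lambda>t. undefined) \<in> borel_measurable (restrict_space ?M {t. t \<notin> S})" using u(1) by simp
    qed
    moreover have ae: "AE t in ?M. t \<in> S" using AE_not_in[OF N] by (rule AE_mp) (auto simp: S_def)
    from ae have "AE t in ?M. u' t \<in> U t (\<mu> t)" by eventually_elim (use u(2) in \<open>simp add: u'_def F_def\<close>)
    moreover have "AE t in ?M. w t = (\<lambda>x. v t (\<mu> t) (u' t) x)"
      using ae by eventually_elim (use u(2) in \<open>simp add: u'_def g_def\<close>)
    from solves_continuity_eq_AE_cong[OF sol this]
    have "solves_continuity_eq T (\<lambda>t x. v t (\<mu> t) (u' t) x) \<mu>0 \<mu>" .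
    ultimately show "\<exists>u. measurable_selection T borel (\<lambda>t. U t (\<mu> t)) u \<and>
        solves_continuity_eq T (\<lambda>t x. v t (\<mu> t) (u t) x) \<mu>0 \<mu>"
      unfolding measurable_selection_def by blast
  next
    assume "\<exists>u. measurable_selection T borel (\<lambda>t. U t (\<mu> t)) u \<and>
        solves_continuity_eq T (\<lambda>t x. v t (\<mu> t) (u t) x) \<mu>0 \<mu>"
    then obtain u where u: "u \<in> borel_measurable ?M" "AE t in ?M. u t \<in> F t"
      and sol: "solves_continuity_eq T (\<lambda>t. g t (u t)) \<mu>0 \<mu>"
      unfolding measurable_selection_def F_def g_def by blast
    from u(2) D(2) have sep: "AE t in ?M. u t \<in> closure D" by eventually_elim blast
    have "(\<lambda>t. g t (u t)) \<in> measurable ?M C0_borel"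
    proof (rule measurable_C0_borelI)
      show "(\<lambda>t. g t (u t) x) \<in> borel_measurable ?M" for x
        by (rule measurable_caratheodory_compose[where g = "\<lambda>t y. g t y x", OF complete D(1) sep u(1) g_meas])
          (use g_cont in auto)
    qed (use g_C0 in auto)
    moreover have "AE t in ?M. g t (u t) \<in> V t (\<mu> t)"
      using u(2) by eventually_elim (simp add: V_def g_def F_def)
    ultimately show "solves_inclusion T V \<mu>0 \<mu>"
      unfolding solves_inclusion_def measurable_selection_def using sol by blast
  qed
qed

end
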